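(* Let $1\le p\le\infty$ and let $\mathcal R$ be the modified bisection rule (with parameter $\theta\in(0,1)$) defined in the context. Then $$f\in V(f,\mathcal R)_p$$ for any $f\in L^p(\Omega)$ (for any $f\in C(\Omega)$ when $p=\infty$).
   Context: **Setting.** $\Omega\subset\mathbb R^2$ is a compact polygonal domain (such as $[0,1]^2$) and $\mathcal D_0$ is a fixed finite triangulation of $\Omega$ (finitely many non-degenerate closed triangles with union $\Omega$ and pairwise disjoint interiors), independent of $f$. Fix an integer $m\ge0$ and $1\le p\le\infty$. $\Pi_m$ is the space of real bivariate polynomials of total degree at most $m$. **Local approximation.** For each triangle $T$, $\mathcal A_T$ is a linear operator from $L^p(T)$ onto $\Pi_m$ satisfying $$\|f-\mathcal A_Tf\|_{L^p(T)}\le C\inf_{\pi\in\Pi_m}\|f-\pi\|_{L^p(T)}$$ with a constant $C$ independent of $f$ and $T$. Examples: the $L^2(T)$-orthogonal projection $P_T$ onto $\Pi_m$; or, for $p=\infty$ and continuous functions, the Lagrange interpolation operator $I_T$ at the points $\sum_i\frac{k_i}{m}v_i$, $k_i\in\mathbb N$ (nonnegative integers), $\sum_i k_i=m$, where $v_1,v_2,v_3$ are the vertices of $T$ (at the barycenter if $m=0$). The local error is $e_T(f)_p:=\|f-\mathcal A_Tf\|_{L^p(T)}$. **Bisection and hierarchy.** For an edge $e$ of a triangle $T$, bisecting $T$ towards $e$ means splitting $T$ into two triangles $T_e^1,T_e^2$ of equal area by the segment joining the vertex opposite to $e$ to the midpoint of $e$. A refinement rule $\mathcal R$ selects for $f$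 and each triangle $T$ of the hierarchy one of its three edges $e$; the children of $T$ are then $T_e^1,T_e^2$. For $j\ge0$, $\mathcal D_{j+1}$ is the set of all children of the triangles of $\mathcal D_j$. **Modified bisection rule.** Let $d_T(e,f)$ be a decision function, i.e. a real-valued function of the edge $e$ of $T$ (depending on $f$ and $T$), for example $d_T(e,f)=e_{T_e^1}(f)_p^p+e_{T_e^2}(f)_p^p$, and let $\theta\in(0,1)$ be fixed. Given $T$, let $e$ be an edge of $T$ which minimizes $d_T(e,f)$ among the three edges of $T$ (ties broken arbitrarily). If $$\left(e_{T_e^1}(f)_p^p+e_{T_e^2}(f)_p^p\right)^{1/p}\le\theta\,e_T(f)_p\quad(p<\infty),\qquad \max\{e_{T_e^1}(f)_\infty,e_{T_e^2}(f)_\infty\}\le\theta\,e_T(f)_\infty\quad(p=\infty),$$ then $T$ is bisected towards $e$ (greedy bisection). Otherwise $T$ is bisected from its most recently generated vertex towards the midpoint of the opposite edge (newest vertex bisection). For a triangle obtained by bisecting its parent, the most recently generated vertex is the midpoint created by that bisection; for triangles of $\mathcal D_0$ it is some prescribed vertex. **Multiresolution spaces.** $V_j(f,\mathcal R):=\{g:\ g|_T\in\Pi_m\text{ for all }T\in\mathcal D_j\}$, $V(f,\mathcal R):=\bigcup_{j\ge0}V_j(f,\mathcal R)$, and $V(f,\mathcal R)_p$ is the closure of $V(f,\mathcal R)$ in $L^p(\Omega)$. *)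

theory Defs
  imports "HOL-Analysis.Analysis" "HOL-Probability.Essential_Supremum"
begin

section \<open>Lebesgue spaces and polynomials\<close>

type_synonym point = "real^2"

text \<open>Elements of \<open>L\<^sup>p(T)\<close> are represented by functions on the whole plane of which only the
  values on \<open>T\<close> (up to null sets) matter.\<close>

definition Lp_space :: "ennreal \<Rightarrow> point set \<Rightarrow> (point \<Rightarrow> real) set" where
  "Lp_space p T = {f \<in> borel_measurable (lebesgue_on T).
     if p = \<infinity> then esssup (lebesgue_on T) (\<lambda>x. ereal \<bar>f x\<bar>) < \<infinity>
     else integrable (lebesgue_on T) (\<lambda>x. \<bar>f x\<bar> powr enn2real p)}"

definition Lp_norm :: "ennreal \<Rightarrow> point set \<Rightarrow> (point \<Rightarrow> real) \<Rightarrow> real" where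
  "Lp_norm p T f =
     (if p = \<infinity> then real_of_ereal (esssup (lebesgue_on T) (\<lambda>x. ereal \<bar>f x\<bar>))
      else (LINT x|lebesgue_on T. \<bar>f x\<bar> powr enn2real p) powr (1 / enn2real p))"

text \<open>The functions to be approximated: \<open>L\<^sup>p(T)\<close> for \<open>p < \<infinity>\<close>, but \<open>C(T)\<close> for \<open>p = \<infinity>\<close>.\<close>

definition approx_class :: "ennreal \<Rightarrow> point set \<Rightarrow> (point \<Rightarrow> real) set" where
  "approx_class p T = (if p = \<infinity> then {f. continuous_on T f} else Lp_space p T)"

definition Lp_closure :: "ennreal \<Rightarrow> point set \<Rightarrow> (point \<Rightarrow> real) set \<Rightarrow> (point \<Rightarrow> real) set" where
  "Lp_closure p T W =
     {f \<in> Lp_space p T. \<forall>\<epsilon>>0. \<exists>g \<in> W \<inter> Lp_space p T. Lp_norm p T (\<lambda>x. f x - g x) < \<epsilon>}"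

definition poly_space :: "nat \<Rightarrow> (point \<Rightarrow> real) set" where
  "poly_space m =
     {\<pi>. \<exists>c :: nat \<Rightarrow> nat \<Rightarrow> real. \<pi> = (\<lambda>x. \<Sum>i\<le>m. \<Sum>j\<le>m - i. c i j * (x $ 1) ^ i * (x $ 2) ^ j)}"


section \<open>Triangles, bisection and triangulations\<close>

text \<open>A triangle is represented by its set \<open>V\<close> of vertices; the closed triangle itself is
  \<open>convex hull V\<close>. An edge is the set of its two endpoints.\<close>

definition is_triangle :: "point set \<Rightarrow> bool" where
  "is_triangle V \<longleftrightarrow> card V = 3 \<and> \<not> affine_dependent V"

definition edges :: "point set \<Rightarrow> point set set" where
  "edges V = {e. e \<subseteq> V \<and> card e = 2}"

definition edge_midpoint :: "point set \<Rightarrow> point" where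
  "edge_midpoint e = (1 / 2) *\<^sub>R \<Sum>e"

text \<open>Here \<open>V - e\<close> consists of the vertex opposite to \<open>e\<close>, and \<open>x\<close> ranges over the endpoints
  of \<open>e\<close>, each of which belongs to exactly one child.\<close>

definition children :: "point set \<Rightarrow> point set \<Rightarrow> point set set" where
  "children V e = (\<lambda>x. (V - e) \<union> {x, edge_midpoint e}) ` e"

text \<open>Conformity is not required.\<close>

definition triangulates :: "point set \<Rightarrow> point set set \<Rightarrow> bool" where
  "triangulates \<Omega> \<D> \<longleftrightarrow> finite \<D> \<and> (\<forall>V \<in> \<D>. is_triangle V) \<and>
     \<Omega> = (\<Union>V \<in> \<D>. convex hull V) \<and>
     pairwise (\<lambda>V W. interior (convex hull V) \<inter> interior (convex hull W) = {}) \<D>"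

text \<open>A marked triangle \<open>(V, v)\<close> carries its most recently generated vertex \<open>v \<in> V\<close>.
  A refinement rule maps a function \<open>f\<close> and a marked triangle to an edge.\<close>

type_synonym marked = "point set \<times> point"
type_synonym rule = "(point \<Rightarrow> real) \<Rightarrow> marked \<Rightarrow> point set"

text \<open>The parameter \<open>v0\<close> prescribes the newest vertices of the initial triangles.\<close>

primrec hierarchy ::
  "point set set \<Rightarrow> (point set \<Rightarrow> point) \<Rightarrow> rule \<Rightarrow> (point \<Rightarrow> real) \<Rightarrow> nat \<Rightarrow> marked set" where
  "hierarchy \<D>0 v0 R f 0 = (\<lambda>V. (V, v0 V)) ` \<D>0"
| "hierarchy \<D>0 v0 R f (Suc j) =
     (\<Union>T \<in> hierarchy \<D>0 v0 R f j.
        (\<lambda>W. (W, edge_midpoint (R f T))) ` children (fst T) (R f T))"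


section \<open>Local approximation and the modified bisection rule\<close>

text \<open>For \<open>p = \<infinity>\<close> the operators need only be defined on continuous functions, so that Lagrange
  interpolation is covered; any operator on \<open>L\<^sup>\<infinity>(T)\<close> with these properties restricts to
  such an operator. That \<open>A V f\<close> depends only on the class of \<open>f\<close> in \<open>L\<^sup>p(T)\<close> follows from
  linearity and the near-best estimate. Polynomials on a triangle are identified with polynomial
  functions on the plane.\<close>

definition local_approximation ::
  "ennreal \<Rightarrow> nat \<Rightarrow> (point set \<Rightarrow> (point \<Rightarrow> real) \<Rightarrow> point \<Rightarrow> real) \<Rightarrow> bool" where
  "local_approximation p m A \<longleftrightarrow>
     (\<forall>V. is_triangle V \<longrightarrow>
        A V ` approx_class p (convex hull V) = poly_space m \<and>
        (\<forall>f \<in> approx_class p (convex hull V). \<forall>g \<in> approx_class p (convex hull V). \<forall>a b.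
           A V (\<lambda>x. a * f x + b * g x) = (\<lambda>x. a * A V f x + b * A V g x))) \<and>
     (\<exists>C. \<forall>V. is_triangle V \<longrightarrow>
        (\<forall>f \<in> approx_class p (convex hull V).
           Lp_norm p (convex hull V) (\<lambda>x. f x - A V f x)
             \<le> C * (INF \<pi> \<in> poly_space m. Lp_norm p (convex hull V) (\<lambda>x. f x - \<pi> x))))"

definition local_error ::
  "ennreal \<Rightarrow> (point set \<Rightarrow> (point \<Rightarrow> real) \<Rightarrow> point \<Rightarrow> real) \<Rightarrow> (point \<Rightarrow> real) \<Rightarrow> point set \<Rightarrow> real" where
  "local_error p A f V = Lp_norm p (convex hull V) (\<lambda>x. f x - A V f x)"

definition children_error ::
  "ennreal \<Rightarrow> (point set \<Rightarrow> (point \<Rightarrow> real) \<Rightarrow> point \<Rightarrow> real) \<Rightarrow> (point \<Rightarrow> real) \<Rightarrow>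
     point set \<Rightarrow> point set \<Rightarrow> real" where
  "children_error p A f V e =
     (if p = \<infinity> then Max (local_error p A f ` children V e)
      else (\<Sum>W \<in> children V e. local_error p A f W powr enn2real p) powr (1 / enn2real p))"

text \<open>The decision function \<open>d\<close> takes the triangle, the edge and \<open>f\<close>. Any minimizing edge may be
  chosen, so a tie can be broken in any way. The edge opposite to \<open>v\<close> is \<open>V - {v}\<close>.\<close>

definition modified_bisection_rule ::
  "ennreal \<Rightarrow> point set \<Rightarrow> point set set \<Rightarrow> (point set \<Rightarrow> point) \<Rightarrow>
   (point set \<Rightarrow> (point \<Rightarrow> real) \<Rightarrow> point \<Rightarrow> real) \<Rightarrow>
   (point set \<Rightarrow> point set \<Rightarrow> (point \<Rightarrow> real) \<Rightarrow> real) \<Rightarrow> real \<Rightarrow> rule \<Rightarrow> bool" where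
  "modified_bisection_rule p \<Omega> \<D>0 v0 A d \<theta> R \<longleftrightarrow>
     (\<forall>f \<in> approx_class p \<Omega>. \<forall>j. \<forall>(V, v) \<in> hierarchy \<D>0 v0 R f j.
        \<exists>e. is_arg_min (\<lambda>e'. d V e' f) (\<lambda>e'. e' \<in> edges V) e \<and>
            R f (V, v) =
              (if children_error p A f V e \<le> \<theta> * local_error p A f V then e else V - {v}))"


section \<open>Multiresolution spaces\<close>

text \<open>The elements are classes modulo null sets, hence \<open>g|\<^sub>T \<in> \<Pi>\<^sub>m\<close> is meant almost everywhere
  on \<open>T\<close>: \<open>g\<close> may jump across the edges shared by two triangles.\<close>

definition multires_space_level ::
  "nat \<Rightarrow> point set set \<Rightarrow> (point set \<Rightarrow> point) \<Rightarrow> rule \<Rightarrow> (point \<Rightarrow> real) \<Rightarrow> nat \<Rightarrow>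
     (point \<Rightarrow> real) set" where
  "multires_space_level m \<D>0 v0 R f j =
     {g. \<forall>(V, v) \<in> hierarchy \<D>0 v0 R f j.
           \<exists>\<pi> \<in> poly_space m. AE x in lebesgue_on (convex hull V). g x = \<pi> x}"

definition multires_space ::
  "nat \<Rightarrow> point set set \<Rightarrow> (point set \<Rightarrow> point) \<Rightarrow> rule \<Rightarrow> (point \<Rightarrow> real) \<Rightarrow>
     (point \<Rightarrow> real) set" where
  "multires_space m \<D>0 v0 R f = (\<Union>j. multires_space_level m \<D>0 v0 R f j)"

end

theory Submission
  imports Defs
begin

text \<open>
  Write \<open>e(T)\<close> for the \<open>p\<close>-th power of the local error on \<open>T\<close> (for \<open>p = \<infinity>\<close>: the local error
  itself), and combine the errors of several triangles by addition (for \<open>p = \<infinity>\<close>: by maximum). It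
  suffices to show that the combined error of \<open>\<D>\<^sub>j\<close> becomes arbitrarily small, since \<open>f\<close> is then
  approximated by the function that equals \<open>A\<^sub>T f\<close> on each \<open>T\<close> of \<open>\<D>\<^sub>j\<close>.

  Because the local approximation is near-best, the combined error of the descendants of \<open>T\<close> is at
  most \<open>K e(T)\<close>, and a greedy step reduces it at least by a fixed factor below \<open>1\<close>. A newest vertex step
  is to decrease the diameter instead. One cannot simply distinguish branches with finitely and with
  infinitely many newest vertex steps: long runs of greedy steps in between may preserve a long edge
  almost entirely, so that infinitely many newest vertex steps need not drive the diameter to \<open>0\<close>.
  What does hold is a quantitative statement: \<open>L\<close> bisections in a row, at least three of them newest
  vertex steps, multiply the diameter by at most \<open>1 - 2\<^sup>-\<^sup>L\<close> (\<open>rank_le_child\<close>).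

  The two effects are balanced by an elementary lemma on trees whose steps are of two kinds
  (\<open>few_decay\<close>): if the uncounted steps contract the combined error, and if arbitrary descendants
  never increase it by more than a fixed factor, then for every \<open>n\<close> the descendants that are reached
  with at most \<open>n\<close> counted steps carry an arbitrarily small fraction of the error, provided that
  their level is high enough. This lemma is applied twice.
  \<^item> With newest vertex steps counted and \<open>n = 2\<close>, it gives a block length \<open>L\<close> such that the
    descendants after \<open>L\<close> levels with at most two newest vertex steps (lazy blocks) carry at most
    half of the error. All other descendants after \<open>L\<close> levels (shrinking blocks) have a diameter
    that is smaller by the factor \<open>1 - 2\<^sup>-\<^sup>L\<close>.
  \<^item> With blocks as steps and shrinking blocks counted, it shows that after many blocks the triangles
    reached by few shrinking blocks carry a small error. The others have small diameter, and there
    the error is controlled by the oscillation of \<open>f\<close>: away from a function of small \<open>L\<^sup>p\<close> norm,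
    \<open>f\<close> is continuous (\<open>uniform_majorant\<close>).
\<close>

section \<open>Combining errors over finite families\<close>

text \<open>
  The \<open>p\<close>-th powers of \<open>L\<^sup>p\<close> norms add up over essentially disjoint sets, while for \<open>p = \<infinity>\<close>
  the norms themselves combine by maximum. Both operations are monotone, homogeneous and subadditive,
  and only these properties enter the error estimates. The inserted \<open>0\<close> gives the empty family the
  value \<open>0\<close>; it is harmless because all families are nonnegative.
\<close>

definition agg :: "ennreal \<Rightarrow> ('a \<Rightarrow> real) \<Rightarrow> 'a set \<Rightarrow> real" where
  "agg p w S = (if p = \<infinity> then Max (insert 0 (w ` S)) else sum w S)"

lemma agg_nonneg: "finite S \<Longrightarrow> (\<And>x. x \<in> S \<Longrightarrow> 0 \<le> w x) \<Longrightarrow> 0 \<le> agg p w S"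
  by (auto simp: agg_def intro: sum_nonneg)

lemma agg_empty [simp]: "agg p w {} = 0"
  by (simp add: agg_def)

lemma agg_single: "0 \<le> w x \<Longrightarrow> agg p w {x} = w x"
  by (simp add: agg_def)

lemma agg_mono:
  assumes "finite S" "S' \<subseteq> S" "\<And>x. x \<in> S' \<Longrightarrow> w' x \<le> w x" "\<And>x. x \<in> S \<Longrightarrow> 0 \<le> w x"
  shows "agg p w' S' \<le> agg p w S"
proof (cases "p = \<infinity>")
  case True
  have "finite S'" using assms finite_subset by blast
  have "w' x \<le> Max (insert 0 (w ` S))" if "x \<in> S'" for x
    by (rule order_trans[OF assms(3)[OF that]]) (use assms(1,2) that in auto)
  then show ?thesis using True assms(1) \<open>finite S'\<close> by (simp add: agg_def)
next
  case False
  have "sum w' S' \<le> sum w S'" by (rule sum_mono) (use assms in auto)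
  also have "\<dots> \<le> sum w S" by (rule sum_mono2) (use assms in auto)
  finally show ?thesis using False by (simp add: agg_def)
qed

lemma agg_scale:
  assumes "finite S" "0 \<le> c"
  shows "agg p (\<lambda>x. c * w x) S = c * agg p w S"
proof (cases "p = \<infinity>")
  case True
  have "c * Max (insert 0 (w ` S)) = Max ((*) c ` insert 0 (w ` S))"
    by (rule mono_Max_commute) (use assms in \<open>auto intro: monoI mult_left_mono\<close>)
  also have "(*) c ` insert 0 (w ` S) = insert 0 ((\<lambda>x. c * w x) ` S)" by auto
  finally show ?thesis using True by (simp add: agg_def)
qed (simp add: agg_def sum_distrib_left)

lemma agg_Union:
  assumes "finite S" "\<And>x. x \<in> S \<Longrightarrow> finite (F x)"
    and "\<And>x y. x \<in> S \<Longrightarrow> y \<in> F x \<Longrightarrow> 0 \<le> w y"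
  shows "agg p w (\<Union>x\<in>S. F x) \<le> agg p (\<lambda>x. agg p w (F x)) S"
proof (cases "p = \<infinity>")
  case True
  have "\<exists>u\<in>S. w y \<le> Max (insert 0 (w ` F u))" if "x \<in> S" "y \<in> F x" for x y
    using that assms by (intro bexI[of _ x]) auto
  then have "w y \<le> Max (insert 0 ((\<lambda>u. Max (insert 0 (w ` F u))) ` S))"
    if "y \<in> (\<Union>x\<in>S. F x)" for y
    using that assms(1) by (subst Max_ge_iff) auto
  moreover have "0 \<le> Max (insert 0 ((\<lambda>u. Max (insert 0 (w ` F u))) ` S))"
    using assms(1) by (intro Max_ge) auto
  ultimately show ?thesis using True assms(1,2) by (simp add: agg_def)
next
  case False
  have "sum w (\<Union>x\<in>S. F x) \<le> (\<Sum>x\<in>S. sum w (F x))"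
    using assms(1,2,3)
  proof (induction S rule: finite_induct)
    case (insert a S)
    have "sum w (F a \<union> (\<Union>x\<in>S. F x)) \<le> sum w (F a) + sum w (\<Union>x\<in>S. F x)"
      using insert.prems insert.hyps
      by (subst sum_Un) (auto intro!: sum_nonneg)
    also have "sum w (\<Union>x\<in>S. F x) \<le> (\<Sum>x\<in>S. sum w (F x))"
      by (rule insert.IH) (use insert.prems in auto)
    finally show ?case using insert.hyps by simp
  qed simp
  with False show ?thesis by (simp add: agg_def)
qed

lemma agg_Un:
  assumes "finite S" "finite S'" "\<And>x. x \<in> S \<union> S' \<Longrightarrow> 0 \<le> w x"
  shows "agg p w (S \<union> S') \<le> agg p w S + agg p w S'"
proof (cases "p = \<infinity>")
  case True
  have "0 \<le> agg p w S" "0 \<le> agg p w S'" using assms by (auto intro: agg_nonneg)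
  moreover have "w x \<le> agg p w S" if "x \<in> S" for x
    using True that assms by (auto simp: agg_def)
  moreover have "w x \<le> agg p w S'" if "x \<in> S'" for x
    using True that assms by (auto simp: agg_def)
  ultimately have "\<forall>x\<in>S \<union> S'. w x \<le> agg p w S + agg p w S'" "0 \<le> agg p w S + agg p w S'"
    by (auto simp: add_increasing add_increasing2)
  then show ?thesis using True assms
    by (subst agg_def) auto
next
  case False
  with assms show ?thesis by (auto simp: agg_def sum_Un intro!: sum_nonneg)
qed

lemma agg_Union_le:
  assumes "finite S" "\<And>x. x \<in> S \<Longrightarrow> finite (F x)"
    and "\<And>x y. x \<in> S \<Longrightarrow> y \<in> F x \<Longrightarrow> 0 \<le> w y"
    and "\<And>x. x \<in> S \<Longrightarrow> agg p w (F x) \<le> c * u x" "0 \<le> c" "\<And>x. x \<in> S \<Longrightarrow> 0 \<le> u x"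
  shows "agg p w (\<Union>x\<in>S. F x) \<le> c * agg p u S"
proof -
  have "agg p w (\<Union>x\<in>S. F x) \<le> agg p (\<lambda>x. agg p w (F x)) S"
    by (rule agg_Union) (use assms in auto)
  also have "\<dots> \<le> agg p (\<lambda>x. c * u x) S"
    by (rule agg_mono) (use assms in auto)
  finally show ?thesis using assms by (simp add: agg_scale)
qed

lemma agg_le_card:
  assumes "finite S" "\<And>x. x \<in> S \<Longrightarrow> w x \<le> c" "0 \<le> c"
  shows "agg p w S \<le> real (card S) * c"
proof (cases "p = \<infinity>")
  case True
  have "w x \<le> real (card S) * c" if "x \<in> S" for x
  proof -
    have "1 \<le> card S" using that assms(1) by (metis One_nat_def Suc_leI card_gt_0_iff empty_iff)
    then have "1 * c \<le> real (card S) * c" using assms(3) by (intro mult_right_mono) auto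
    with assms(2)[OF that] show ?thesis by simp
  qed
  with True assms show ?thesis by (auto simp: agg_def)
next
  case False
  with sum_bounded_above[of S w c] assms show ?thesis by (simp add: agg_def)
qed

section \<open>Trees with few counted steps\<close>

primrec desc :: "('a \<Rightarrow> 'a set) \<Rightarrow> nat \<Rightarrow> 'a \<Rightarrow> 'a set" where
  "desc kids 0 T = {T}"
| "desc kids (Suc j) T = (\<Union>T'\<in>kids T. desc kids j T')"

text \<open>
  A step from a node leads either to its \<open>lo\<close> successors or to its \<open>hi\<close> successors; only \<open>hi\<close>
  steps are counted. The sets \<open>few\<close> and \<open>many\<close> collect the descendants that are reached after
  \<open>j\<close> steps of which at most, respectively at least, \<open>n\<close> are counted.
\<close>

primrec few :: "('a \<Rightarrow> 'a set) \<Rightarrow> ('a \<Rightarrow> 'a set) \<Rightarrow> nat \<Rightarrow> nat \<Rightarrow> 'a \<Rightarrow> 'a set" where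
  "few lo hi 0 n T = {T}"
| "few lo hi (Suc j) n T = (\<Union>T'\<in>lo T. few lo hi j n T') \<union>
     (case n of 0 \<Rightarrow> {} | Suc i \<Rightarrow> (\<Union>T'\<in>hi T. few lo hi j i T'))"

primrec many :: "('a \<Rightarrow> 'a set) \<Rightarrow> ('a \<Rightarrow> 'a set) \<Rightarrow> nat \<Rightarrow> nat \<Rightarrow> 'a \<Rightarrow> 'a set" where
  "many lo hi 0 n T = (if n = 0 then {T} else {})"
| "many lo hi (Suc j) n T =
     (\<Union>T'\<in>lo T. many lo hi j n T') \<union> (\<Union>T'\<in>hi T. many lo hi j (n - 1) T')"

lemma desc_add: "desc kids (i + j) T = (\<Union>T'\<in>desc kids i T. desc kids j T')"
  by (induction i arbitrary: T) auto

lemma desc_subset_few_many: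
  "desc (\<lambda>T. lo T \<union> hi T) j T \<subseteq> few lo hi j n T \<union> many lo hi j (Suc n) T"
proof (induction j arbitrary: T n)
  case (Suc j)
  have all: "desc (\<lambda>T. lo T \<union> hi T) j T' \<subseteq> many lo hi j 0 T'" for T'
    by (induction j arbitrary: T') auto
  show ?case
  proof
    fix S assume "S \<in> desc (\<lambda>T. lo T \<union> hi T) (Suc j) T"
    then obtain T' where T': "T' \<in> lo T \<union> hi T" "S \<in> desc (\<lambda>T. lo T \<union> hi T) j T'" by auto
    then show "S \<in> few lo hi (Suc j) n T \<union> many lo hi (Suc j) (Suc n) T"
      using Suc.IH[of T' n] Suc.IH[of T' "n - 1"] all[of T'] by (cases n) auto
  qed
qed simp

lemma few_subset_desc: "few lo hi j n T \<subseteq> desc (\<lambda>T. lo T \<union> hi T) j T"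
proof (induction j arbitrary: T n)
  case (Suc j)
  then have "(\<Union>T'\<in>S. few lo hi j n T') \<subseteq> (\<Union>T'\<in>S. desc (\<lambda>T. lo T \<union> hi T) j T')" for S n
    by (intro UN_mono) auto
  from this[of n "lo T"] this[of "n - 1" "hi T"] show ?case
    by (cases n) auto
qed simp

lemma many_subset_desc: "many lo hi j n T \<subseteq> desc (\<lambda>T. lo T \<union> hi T) j T"
proof (induction j arbitrary: T n)
  case (Suc j)
  then have "(\<Union>T'\<in>S. many lo hi j n T') \<subseteq> (\<Union>T'\<in>S. desc (\<lambda>T. lo T \<union> hi T) j T')" for S n
    by (intro UN_mono) auto
  from this[of n "lo T"] this[of "n - 1" "hi T"] show ?case by auto
qed simp

lemma few_mono_Suc: "few lo hi j n T \<subseteq> few lo hi j (Suc n) T"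
proof (induction j arbitrary: T n)
  case (Suc j)
  then have "(\<Union>T'\<in>S. few lo hi j n T') \<subseteq> (\<Union>T'\<in>S. few lo hi j (Suc n) T')" for S n
    by (intro UN_mono) auto
  from this[of n "lo T"] this[of "n - 1" "hi T"] show ?case by (cases n) auto
qed simp

lemma few_subset_after:
  "few lo hi (k + j) n T \<subseteq> (\<Union>T'\<in>desc (\<lambda>T. lo T \<union> hi T) k T. few lo hi j n T')"
proof (induction k arbitrary: T n)
  case (Suc k)
  let ?D = "desc (\<lambda>T. lo T \<union> hi T)"
  show ?case
  proof
    fix S assume S: "S \<in> few lo hi (Suc k + j) n T"
    obtain T' where T': "T' \<in> lo T \<union> hi T" "S \<in> few lo hi (k + j) n T'"
    proof (cases n)
      case 0
      with S that show ?thesis by auto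
    next
      case (Suc i)
      with S that few_mono_Suc[of lo hi "k + j" i] show ?thesis by auto
    qed
    then obtain T'' where "T'' \<in> ?D k T'" "S \<in> few lo hi j n T''"
      using Suc.IH[of n T'] by blast
    with T'(1) show "S \<in> (\<Union>T'\<in>?D (Suc k) T. few lo hi j n T')"
      by (intro UN_I[of T'']) auto
  qed
qed simp

text \<open>
  Either none of the first \<open>k\<close> steps is counted, or one of the counted steps is used up and at most
  \<open>n\<close> are left for the remaining \<open>j\<close> steps. Splitting at a fixed level \<open>k\<close>, and not at the first
  counted step, keeps the number of terms in the induction on \<open>n\<close> at two.
\<close>

lemma few_split:
  "few lo hi (k + j) (Suc n) T \<subseteq>
     (\<Union>T'\<in>few lo hi k 0 T. desc (\<lambda>T. lo T \<union> hi T) j T') \<union>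
     (\<Union>T'\<in>desc (\<lambda>T. lo T \<union> hi T) k T. few lo hi j n T')"
proof (induction k arbitrary: T)
  case 0
  then show ?case using few_subset_desc[of lo hi j "Suc n" T] by auto
next
  case (Suc k)
  show ?case
  proof
    fix S assume "S \<in> few lo hi (Suc k + j) (Suc n) T"
    then consider T' where "T' \<in> lo T" "S \<in> few lo hi (k + j) (Suc n) T'"
      | T' where "T' \<in> hi T" "S \<in> few lo hi (k + j) n T'" by auto
    then show "S \<in> (\<Union>T'\<in>few lo hi (Suc k) 0 T. desc (\<lambda>T. lo T \<union> hi T) j T') \<union>
        (\<Union>T'\<in>desc (\<lambda>T. lo T \<union> hi T) (Suc k) T. few lo hi j n T')"
    proof cases
      case 1
      with Suc.IH[of T'] consider T'' where "T'' \<in> few lo hi k 0 T'" "S \<in> desc (\<lambda>T. lo T \<union> hi T) j T''"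
        | T'' where "T'' \<in> desc (\<lambda>T. lo T \<union> hi T) k T'" "S \<in> few lo hi j n T''"
        by blast
      then show ?thesis
      proof cases
        case (1 T'')
        with \<open>T' \<in> lo T\<close> show ?thesis by (intro UnI1 UN_I[of T'']) auto
      next
        case (2 T'')
        with \<open>T' \<in> lo T\<close> show ?thesis by (intro UnI2 UN_I[of T'']) auto
      qed
    next
      case 2
      then obtain T'' where "T'' \<in> desc (\<lambda>T. lo T \<union> hi T) k T'" "S \<in> few lo hi j n T''"
        using few_subset_after[of lo hi k j n T'] by blast
      with \<open>T' \<in> hi T\<close> show ?thesis by (intro UnI2 UN_I[of T'']) auto
    qed
  qed
qed

text \<open>
  Counted steps may increase the combined weight, but not cumulatively: at every level, however
  deep, the descendants of \<open>T\<close> together weigh at most \<open>K w(T)\<close>. Uncounted steps contract the weight.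
\<close>

locale decaying_tree =
  fixes p :: ennreal and lo hi :: "'a \<Rightarrow> 'a set" and H :: "'a set" and w :: "'a \<Rightarrow> real"
    and K q :: real
  assumes finite_lo: "T \<in> H \<Longrightarrow> finite (lo T)" and finite_hi: "T \<in> H \<Longrightarrow> finite (hi T)"
    and closed: "T \<in> H \<Longrightarrow> lo T \<union> hi T \<subseteq> H"
    and w_nonneg: "T \<in> H \<Longrightarrow> 0 \<le> w T"
    and K_nonneg: "0 \<le> K" and q_nonneg: "0 \<le> q" and q_less: "q < 1"
    and lo_decay: "T \<in> H \<Longrightarrow> agg p w (lo T) \<le> q * w T"
    and desc_bound: "T \<in> H \<Longrightarrow> agg p w (desc (\<lambda>T. lo T \<union> hi T) j T) \<le> K * w T"
begin

abbreviation "all_kids \<equiv> (\<lambda>T. lo T \<union> hi T)"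

lemma kid_in: "T \<in> H \<Longrightarrow> T' \<in> lo T \<Longrightarrow> T' \<in> H" "T \<in> H \<Longrightarrow> T' \<in> hi T \<Longrightarrow> T' \<in> H"
  using closed by blast+

lemma desc_in: "T \<in> H \<Longrightarrow> S \<in> desc all_kids j T \<Longrightarrow> S \<in> H"
  by (induction j arbitrary: T) (auto dest: kid_in)

lemma finite_desc: "T \<in> H \<Longrightarrow> finite (desc all_kids j T)"
  by (induction j arbitrary: T) (auto dest: kid_in intro: finite_lo finite_hi)

lemma finite_few: "T \<in> H \<Longrightarrow> finite (few lo hi j n T)"
  by (rule finite_subset[OF few_subset_desc finite_desc])

lemma few_in: "T \<in> H \<Longrightarrow> S \<in> few lo hi j n T \<Longrightarrow> S \<in> H"
  using few_subset_desc[of lo hi j n T] desc_in[of T S j] by blast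

lemma few_0_decay: "T \<in> H \<Longrightarrow> agg p w (few lo hi k 0 T) \<le> q ^ k * w T"
proof (induction k arbitrary: T)
  case 0
  then show ?case using w_nonneg by (simp add: agg_single)
next
  case (Suc k)
  have kid: "T' \<in> H" if "T' \<in> lo T" for T'
    using Suc.prems that by (rule kid_in)
  have "agg p w (\<Union>T'\<in>lo T. few lo hi k 0 T') \<le> q ^ k * agg p w (lo T)"
  proof (rule agg_Union_le)
    show "finite (few lo hi k 0 T')" if "T' \<in> lo T" for T'
      using finite_few[OF kid[OF that]] .
    show "0 \<le> w S" if "T' \<in> lo T" "S \<in> few lo hi k 0 T'" for T' S
      using w_nonneg[OF few_in[OF kid[OF that(1)] that(2)]] .
  qed (use Suc q_nonneg in \<open>simp_all add: finite_lo w_nonneg kid\<close>)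
  also have "\<dots> \<le> q ^ k * (q * w T)"
    using Suc.prems lo_decay q_nonneg by (intro mult_left_mono) auto
  finally show ?case by (simp add: mult_ac)
qed

text \<open>
  Induction on \<open>n\<close> with \<open>few_split\<close>: the descendants without counted step in the first \<open>k\<close>
  levels have weight at most \<open>q\<^sup>k w(T)\<close>, which the rest of the tree multiplies by at most \<open>K\<close>; for the
  others the induction hypothesis applies from level \<open>k\<close> on, where the total weight is at most
  \<open>K w(T)\<close>.
\<close>

lemma few_decay:
  assumes "0 < \<eta>"
  shows "\<exists>j. \<forall>T\<in>H. agg p w (few lo hi j n T) \<le> \<eta> * w T"
  using assms
proof (induction n arbitrary: \<eta>)
  case 0
  obtain k where k: "q ^ k < \<eta>"
    using real_arch_pow_inv[OF 0 q_less] by blast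
  have "agg p w (few lo hi k 0 T) \<le> \<eta> * w T" if "T \<in> H" for T
    using order_trans[OF few_0_decay[OF that, of k] mult_right_mono[OF less_imp_le[OF k] w_nonneg[OF that]]] .
  then show ?case by blast
next
  case (Suc n)
  \<comment> \<open>\<open>K + 1\<close> instead of \<open>K\<close>, since \<open>K\<close> may be \<open>0\<close>.\<close>
  define \<eta>' where "\<eta>' = \<eta> / (2 * (K + 1))"
  have \<eta>': "0 < \<eta>'" "K * \<eta>' \<le> \<eta> / 2"
    using Suc.prems K_nonneg by (auto simp: \<eta>'_def field_simps)
  obtain j where j: "\<And>T. T \<in> H \<Longrightarrow> agg p w (few lo hi j n T) \<le> \<eta>' * w T"
    using Suc.IH[OF \<eta>'(1)] by blast
  obtain k where k: "q ^ k < \<eta>'"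
    using real_arch_pow_inv[OF \<eta>'(1) q_less] by blast
  have "agg p w (few lo hi (k + j) (Suc n) T) \<le> \<eta> * w T" if T: "T \<in> H" for T
  proof -
    let ?A = "\<Union>T'\<in>few lo hi k 0 T. desc all_kids j T'"
    let ?B = "\<Union>T'\<in>desc all_kids k T. few lo hi j n T'"
    have fin: "finite ?A" "finite ?B"
      by (simp_all add: finite_few finite_desc T few_in[OF T] desc_in[OF T])
    have sub: "?A \<union> ?B \<subseteq> H"
      using few_in[OF desc_in[OF T]] desc_in[OF few_in[OF T]] by blast
    have "agg p w ?A \<le> K * agg p w (few lo hi k 0 T)"
    proof (rule agg_Union_le)
      show "0 \<le> w S" if "T' \<in> few lo hi k 0 T" "S \<in> desc all_kids j T'" for T' S
        using w_nonneg[OF desc_in[OF few_in[OF T that(1)] that(2)]] .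
    qed (simp_all add: finite_few finite_desc T w_nonneg desc_bound K_nonneg few_in[OF T])
    also have "\<dots> \<le> K * (\<eta>' * w T)"
      using order_trans[OF few_0_decay[OF T, of k] mult_right_mono[OF less_imp_le[OF k] w_nonneg[OF T]]]
        K_nonneg
      by (rule mult_left_mono)
    finally have A: "agg p w ?A \<le> K * \<eta>' * w T" by simp
    have "agg p w ?B \<le> \<eta>' * agg p w (desc all_kids k T)"
    proof (rule agg_Union_le)
      show "0 \<le> w S" if "T' \<in> desc all_kids k T" "S \<in> few lo hi j n T'" for T' S
        using w_nonneg[OF few_in[OF desc_in[OF T that(1)] that(2)]] .
    qed (use \<eta>' in \<open>simp_all add: finite_few finite_desc T w_nonneg j desc_in[OF T]\<close>)
    also have "\<dots> \<le> \<eta>' * (K * w T)"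
      using desc_bound[OF T] \<eta>' by (intro mult_left_mono) auto
    finally have B: "agg p w ?B \<le> K * \<eta>' * w T" by (simp add: mult_ac)
    have "agg p w (few lo hi (k + j) (Suc n) T) \<le> agg p w (?A \<union> ?B)"
      using fin sub w_nonneg few_split[of lo hi k j n T] by (intro agg_mono) auto
    also have "\<dots> \<le> agg p w ?A + agg p w ?B"
      using fin sub w_nonneg by (intro agg_Un) auto
    also have "\<dots> \<le> 2 * (K * \<eta>') * w T" using A B by simp
    also have "\<dots> \<le> \<eta> * w T"
      using \<eta>' w_nonneg[OF T] by (intro mult_right_mono) auto
    finally show ?thesis .
  qed
  then show ?case by blast
qed

end

section \<open>Bisection of triangles and the diameter\<close>

lemma triangle_edge_cases:
  assumes "is_triangle V" "e \<in> edges V"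
  obtains o' x y where "V = {o', x, y}" "e = {x, y}" "distinct [o', x, y]"
proof -
  from assms have V: "card V = 3" and e: "e \<subseteq> V" "card e = 2"
    by (auto simp: is_triangle_def edges_def)
  have "finite V" using V by (metis card.infinite zero_neq_numeral)
  then have "card (V - e) = 1" using V e by (subst card_Diff_subset) (auto intro: finite_subset)
  then obtain o' where o: "V - e = {o'}" by (meson card_1_singletonE)
  obtain x y where "e = {x, y}" "x \<noteq> y" using e(2) by (meson card_2_iff)
  moreover have "V = insert o' e" using o e(1) by blast
  ultimately show ?thesis using that[of o' x y] o by auto
qed

lemma edge_midpoint_pair: "x \<noteq> y \<Longrightarrow> edge_midpoint {x, y} = midpoint x y"
  by (simp add: edge_midpoint_def midpoint_def)

lemma children_triple:
  assumes "distinct [o', x, y]"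
  shows "children {o', x, y} {x, y} = {{o', x, midpoint x y}, {o', y, midpoint x y}}"
proof -
  have "{o', x, y} - {x, y} = {o'}" using assms by auto
  then show ?thesis using assms by (simp add: children_def edge_midpoint_pair insert_commute)
qed

lemma is_triangle_triple:
  "is_triangle {a, b, c} \<longleftrightarrow> \<not> collinear {a, b, c}"
proof -
  have "card {a, b, c} = 3 \<longleftrightarrow> distinct [a, b, c]"
    by (simp add: card_insert_if)
  then show ?thesis
    unfolding is_triangle_def collinear_3_eq_affine_dependent by auto
qed

text \<open>
  If a half were degenerate, the line through one endpoint of the bisected edge and its midpoint
  would contain the third vertex as well as the other endpoint.
\<close>

lemma is_triangle_half:
  assumes "is_triangle {o', x, y}"
  shows "is_triangle {o', x, midpoint x y}"
proof -
  have "\<not> collinear {o', x, y}" using assms by (simp add: is_triangle_triple)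
  moreover have "x \<noteq> midpoint x y"
    using calculation by (metis collinear_2 insert_absorb2 midpoint_eq_endpoint(1))
  moreover have "collinear {x, midpoint x y, y}"
    using between_midpoint(1)[of x y] between_imp_collinear[of x y "midpoint x y"]
    by (simp add: insert_commute)
  ultimately show ?thesis
    unfolding is_triangle_triple using collinear_3_trans by blast
qed

lemma midpoint_in_hull: "midpoint x y \<in> convex hull {o', x, y}"
proof -
  have "midpoint x y \<in> closed_segment x y" by (simp add: midpoint_in_closed_segment)
  also have "\<dots> \<subseteq> convex hull {o', x, y}"
    by (simp add: segment_convex_hull hull_mono subset_insertI)
  finally show ?thesis .
qed

lemma half_subset: "convex hull {o', x, midpoint x y} \<subseteq> convex hull {o', x, y}"
  by (rule hull_minimal) (use midpoint_in_hull hull_subset[of "{o',x,y}" convex] in auto)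

text \<open>
  In barycentric coordinates, the half containing a point is determined by which endpoint of the
  bisected edge has the larger coordinate.
\<close>

lemma halves_cover:
  "convex hull {o', x, y} \<subseteq> convex hull {o', x, midpoint x y} \<union> convex hull {o', y, midpoint x y}"
proof
  fix z assume "z \<in> convex hull {o', x, y}"
  then obtain a b c where abc: "0 \<le> a" "0 \<le> b" "0 \<le> c" "a + b + c = 1"
    "z = a *\<^sub>R o' + b *\<^sub>R x + c *\<^sub>R y" unfolding convex_hull_3 by blast
  show "z \<in> convex hull {o', x, midpoint x y} \<union> convex hull {o', y, midpoint x y}"
  proof (cases "c \<le> b")
    case True
    have "z = a *\<^sub>R o' + (b - c) *\<^sub>R x + (2 * c) *\<^sub>R midpoint x y"
      using abc(5) by (simp add: midpoint_def algebra_simps)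
    then show ?thesis using True abc unfolding convex_hull_3
      by (intro UnI1 CollectI exI[of _ a] exI[of _ "b - c"] exI[of _ "2 * c"]) auto
  next
    case False
    have "z = a *\<^sub>R o' + (c - b) *\<^sub>R y + (2 * b) *\<^sub>R midpoint x y"
      using abc(5) by (simp add: midpoint_def algebra_simps)
    then show ?thesis using False abc unfolding convex_hull_3
      by (intro UnI2 CollectI exI[of _ a] exI[of _ "c - b"] exI[of _ "2 * b"]) auto
  qed
qed

text \<open>
  Equating two representations of a common point, uniqueness of barycentric coordinates leaves no
  room for a positive coefficient at either endpoint of the bisected edge.
\<close>

lemma halves_meet:
  assumes "is_triangle {o', x, y}"
  shows "convex hull {o', x, midpoint x y} \<inter> convex hull {o', y, midpoint x y}
    \<subseteq> convex hull {o', midpoint x y}"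
proof
  let ?m = "midpoint x y"
  fix z assume "z \<in> convex hull {o', x, ?m} \<inter> convex hull {o', y, ?m}"
  then obtain a b c a' b' c' where
    abc: "0 \<le> a" "0 \<le> b" "0 \<le> c" "a + b + c = 1" "z = a *\<^sub>R o' + b *\<^sub>R x + c *\<^sub>R ?m"
    and abc': "0 \<le> a'" "0 \<le> b'" "0 \<le> c'" "a' + b' + c' = 1" "z = a' *\<^sub>R o' + b' *\<^sub>R y + c' *\<^sub>R ?m"
    unfolding convex_hull_3 by blast
  have dist: "o' \<noteq> x" "o' \<noteq> y" "x \<noteq> y"
    using assms unfolding is_triangle_triple collinear_3_eq_affine_dependent by auto
  \<comment> \<open>The differences of the barycentric coordinates in the two representations of \<open>z\<close>.\<close>
  define u where "u p = (if p = o' then a - a' else if p = x then b + (c - c') / 2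
    else (c - c') / 2 - b')" for p
  have "sum u {o', x, y} = 0" using dist abc(4) abc'(4) by (simp add: u_def field_simps)
  moreover have "(\<Sum>p\<in>{o', x, y}. u p *\<^sub>R p) = (a *\<^sub>R o' + b *\<^sub>R x + c *\<^sub>R ?m) - (a' *\<^sub>R o' + b' *\<^sub>R y + c' *\<^sub>R ?m)"
    using dist by (simp add: u_def midpoint_def algebra_simps diff_divide_distrib)
  then have "(\<Sum>p\<in>{o', x, y}. u p *\<^sub>R p) = 0" using abc(5) abc'(5) by simp
  ultimately have "\<forall>p\<in>{o', x, y}. u p = 0"
    using assms unfolding is_triangle_def 
      affine_dependent_explicit_finite[OF finite.insertI[OF finite.insertI[OF finite.insertI[OF finite.emptyI]]]]
    by blast
  then have "b + (c - c') / 2 = 0" "(c - c') / 2 - b' = 0" using dist by (auto simp: u_def)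
  then have "b = 0" using abc(2) abc'(2) by linarith
  then show "z \<in> convex hull {o', ?m}"
    using abc by (auto simp: convex_hull_2)
qed

lemma negligible_hull_pair: "negligible (convex hull {a, b :: point})"
proof -
  have "interior (convex hull {a, b}) = {}"
    by (rule empty_interior_convex_hull) (auto simp: card_insert_if)
  then show ?thesis by (simp add: negligible_convex_interior)
qed

lemma negligible_inter_hulls:
  fixes V W :: "point set"
  assumes "interior (convex hull V) \<inter> interior (convex hull W) = {}"
  shows "negligible (convex hull V \<inter> convex hull W)"
  using assms by (subst negligible_convex_interior) (auto intro: convex_Int)

text \<open>
  For a set of vertices this bounds the edge lengths, and hence the diameter of the triangle.
\<close>

definition diam_le :: "point set \<Rightarrow> real \<Rightarrow> bool" where
  "diam_le V D \<longleftrightarrow> (\<forall>x\<in>V. \<forall>y\<in>V. dist x y \<le> D)"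

lemma diam_le_hull: "diam_le V D \<Longrightarrow> diam_le (convex hull V) D"
proof -
  assume V: "diam_le V D"
  have 1: "convex hull V \<subseteq> cball x D" if "x \<in> V" for x
    by (rule hull_minimal) (use V that in \<open>auto simp: diam_le_def\<close>)
  have "convex hull V \<subseteq> cball y D" if "y \<in> convex hull V" for y
  proof (rule hull_minimal)
    show "V \<subseteq> cball y D" using 1 that by (fastforce simp: dist_commute)
  qed simp
  then show ?thesis unfolding diam_le_def by (meson mem_cball subsetD)
qed

text \<open>
  Let \<open>D\<close> bound the diameter of an ancestor, and call an edge short if its length is at most
  \<open>(1 - \<delta>) D\<close>. Up to rank \<open>2\<close> some edge at the newest vertex \<open>v\<close> is short, up to rank \<open>1\<close> both
  of them are, and at rank \<open>0\<close> all three edges are. The edges at \<open>v\<close> play a special role because a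
  newest vertex bisection splits the edge opposite to \<open>v\<close>, the only one that may be long at
  rank \<open>1\<close>.
\<close>

definition rank_le :: "nat \<Rightarrow> real \<Rightarrow> real \<Rightarrow> marked \<Rightarrow> bool" where
  "rank_le r D \<delta> = (\<lambda>(V, v). diam_le V D \<and>
     (r \<le> 2 \<longrightarrow> (\<exists>x\<in>V - {v}. dist v x \<le> (1 - \<delta>) * D)) \<and>
     (r \<le> 1 \<longrightarrow> (\<forall>x\<in>V. dist v x \<le> (1 - \<delta>) * D)) \<and>
     (r = 0 \<longrightarrow> diam_le V ((1 - \<delta>) * D)))"

text \<open>
  A child has one edge of its parent, half of the bisected edge, and the median as edges. The half
  edge is at most \<open>D/2\<close>, and the median is at most the mean of the two edges adjacent to it, hence
  short with \<open>\<delta>/2\<close> in place of \<open>\<delta>\<close> as soon as one of them is short with \<open>\<delta>\<close>. Both of these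
  edges end in the new newest vertex. At rank \<open>1\<close> one of the edges adjacent to the median ends in the
  old newest vertex and is short, so that no bisection increases the rank. If the bisected edge is
  the one opposite to the newest vertex, the median is short already at rank \<open>2\<close> and the edge kept
  from the parent is short at rank \<open>1\<close>, so that the rank drops.
\<close>

lemma rank_le_half:
  assumes V: "V = {o', x, y}" "distinct [o', x, y]" and v: "v \<in> V"
    and \<delta>: "0 \<le> \<delta>" "\<delta> \<le> 1" and r: "rank_le r D \<delta> (V, v)"
  shows "rank_le (if v = o' then r - 1 else r) D (\<delta> / 2) ({o', x, midpoint x y}, midpoint x y)"
proof -
  let ?m = "midpoint x y"
  have D: "dist o' x \<le> D" "dist o' y \<le> D" "dist x y \<le> D"
    using r V by (auto simp: rank_le_def diam_le_def)
  have "0 \<le> D" using D(1) zero_le_dist[of o' x] by linarith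
  then have half: "D / 2 \<le> (1 - \<delta> / 2) * D" and "0 \<le> \<delta> * D"
    using \<delta> mult_left_le[of \<delta> D] by (auto simp: algebra_simps)
  have mx: "dist ?m x = dist x y / 2" by (simp add: dist_midpoint)
  have "?m - o' = (1/2) *\<^sub>R (x - o') + (1/2) *\<^sub>R (y - o')"
    by (simp add: midpoint_def algebra_simps flip: scaleR_2 scaleR_add_left)
  then have "norm (?m - o') \<le> norm ((1/2) *\<^sub>R (x - o')) + norm ((1/2) *\<^sub>R (y - o'))"
    by (metis norm_triangle_ineq)
  then have mo: "dist ?m o' \<le> (dist o' x + dist o' y) / 2"
    by (simp add: dist_norm norm_minus_commute)
  have ne: "?m \<noteq> x" using V by (simp add: midpoint_eq_endpoint)
  have diam: "diam_le {o', x, ?m} D"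
  proof -
    have "dist ?m x \<le> D" using mx D(3) \<open>0 \<le> D\<close> by linarith
    moreover have "(dist o' x + dist o' y) / 2 \<le> D" using D(1,2) by simp
    with mo have "dist ?m o' \<le> D" by (rule order_trans)
    ultimately
    show ?thesis using D(1) \<open>0 \<le> D\<close> by (simp add: diam_le_def dist_commute)
  qed
  have short2: "dist ?m x \<le> (1 - \<delta> / 2) * D" using mx D half by linarith
  have short: "a / 2 + b / 2 \<le> (1 - \<delta> / 2) * D"
    if "a \<le> (1 - \<delta>) * D \<and> b \<le> D \<or> a \<le> D \<and> b \<le> (1 - \<delta>) * D" for a b
    using that by (auto simp: algebra_simps)
  have short': "a \<le> (1 - \<delta> / 2) * D" if "a \<le> (1 - \<delta>) * D" for a
    using that \<open>0 \<le> \<delta> * D\<close> by (auto simp: algebra_simps)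
  have mo2: "dist ?m o' \<le> (1 - \<delta> / 2) * D"
    if "dist o' x \<le> (1 - \<delta>) * D \<or> dist o' y \<le> (1 - \<delta>) * D"
    using short[of "dist o' x" "dist o' y"] that D mo by (auto simp: add_divide_distrib)
  have s: "0 \<le> (1 - \<delta> / 2) * D" using half \<open>0 \<le> D\<close> by linarith
  have result: "rank_le r' D (\<delta> / 2) ({o', x, ?m}, ?m)"
    if "r' \<le> 1 \<Longrightarrow> dist ?m o' \<le> (1 - \<delta> / 2) * D" "r' = 0 \<Longrightarrow> dist o' x \<le> (1 - \<delta> / 2) * D" for r'
  proof -
    have "x \<in> {o', x, ?m} - {?m}" using not_sym[OF ne] by (simp only: insert_iff Diff_iff) simp
    then have "\<exists>z\<in>{o', x, ?m} - {?m}. dist ?m z \<le> (1 - \<delta> / 2) * D"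
      using short2 by blast
    moreover have "\<forall>z\<in>{o', x, ?m}. dist ?m z \<le> (1 - \<delta> / 2) * D" if "r' \<le> 1"
      using short2 s \<open>r' \<le> 1 \<Longrightarrow> dist ?m o' \<le> _\<close> that by simp
    moreover have "diam_le {o', x, ?m} ((1 - \<delta> / 2) * D)" if "r' = 0"
      using calculation(2) \<open>r' = 0 \<Longrightarrow> dist o' x \<le> _\<close> that s
      by (simp add: diam_le_def dist_commute)
    ultimately show ?thesis using diam by (simp add: rank_le_def)
  qed
  show ?thesis
  proof (cases "v = o'")
    case True
    have "dist o' x \<le> (1 - \<delta>) * D \<or> dist o' y \<le> (1 - \<delta>) * D" if "r \<le> 2"
      using r that V True by (auto simp: rank_le_def)
    moreover have "dist o' x \<le> (1 - \<delta>) * D" if "r \<le> 1"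
      using r that V True by (auto simp: rank_le_def)
    ultimately have "rank_le (r - 1) D (\<delta> / 2) ({o', x, ?m}, ?m)"
      by (intro result) (auto intro: mo2 short')
    then show ?thesis using True by simp
  next
    case False
    have "dist o' x \<le> (1 - \<delta>) * D \<or> dist o' y \<le> (1 - \<delta>) * D" if "r \<le> 1"
      using r that V v False by (auto simp: rank_le_def dist_commute)
    moreover have "dist o' x \<le> (1 - \<delta>) * D" if "r = 0"
      using r that V v by (auto simp: rank_le_def diam_le_def)
    ultimately have "rank_le r D (\<delta> / 2) ({o', x, ?m}, ?m)"
      by (intro result) (auto intro: mo2 short')
    then show ?thesis using False by simp
  qed
qed

lemma rank_le_child:
  assumes tri: "is_triangle V" and e: "e \<in> edges V" and W: "W \<in> children V e" and v: "v \<in> V"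
    and \<delta>: "0 \<le> \<delta>" "\<delta> \<le> 1" and r: "rank_le r D \<delta> (V, v)"
  shows "rank_le (if e = V - {v} then r - 1 else r) D (\<delta> / 2) (W, edge_midpoint e)"
proof -
  obtain o' x y where V: "V = {o', x, y}" "e = {x, y}" "distinct [o', x, y]"
    using triangle_edge_cases[OF tri e] .
  have *: "e = V - {v} \<longleftrightarrow> v = o'" using V v by auto
  have "W = {o', x, midpoint x y} \<or> W = {o', y, midpoint y x}"
    using W V by (simp add: children_triple midpoint_sym)
  moreover have "edge_midpoint e = midpoint x y" using V by (simp add: edge_midpoint_pair)
  moreover have "V = {o', y, x}" "distinct [o', y, x]" using V by auto
  ultimately show ?thesis
    unfolding * using rank_le_half[OF V(1,3) v \<delta> r] rank_le_half[of V o' y x, OF _ _ v \<delta> r]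
    by (auto simp: midpoint_sym)
qed

lemma child_props:
  assumes tri: "is_triangle V" and e: "e \<in> edges V" and W: "W \<in> children V e"
  shows "is_triangle W" "edge_midpoint e \<in> W" "convex hull W \<subseteq> convex hull V"
proof -
  obtain o' x y where V: "V = {o', x, y}" "e = {x, y}" "distinct [o', x, y]"
    using triangle_edge_cases[OF tri e] .
  have V': "V = {o', y, x}" using V by auto
  have W': "W = {o', x, midpoint x y} \<or> W = {o', y, midpoint y x}"
    using W V by (simp add: children_triple midpoint_sym)
  show "is_triangle W" using W' is_triangle_half tri V(1) V' by metis
  show "edge_midpoint e \<in> W" using W' V by (auto simp: edge_midpoint_pair midpoint_sym)
  show "convex hull W \<subseteq> convex hull V" using W' half_subset V(1) V' by metis
qed

lemma children_two:
  assumes tri: "is_triangle V" and e: "e \<in> edges V"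
  obtains W W' where "children V e = {W, W'}" "W \<noteq> W'"
    "convex hull V = convex hull W \<union> convex hull W'" "negligible (convex hull W \<inter> convex hull W')"
    "interior (convex hull W) \<inter> interior (convex hull W') = {}"
proof -
  obtain o' x y where V: "V = {o', x, y}" "e = {x, y}" "distinct [o', x, y]"
    using triangle_edge_cases[OF tri e] .
  let ?W = "{o', x, midpoint x y}" and ?W' = "{o', y, midpoint x y}"
  have c: "children V e = {?W, ?W'}" using V by (simp add: children_triple)
  have n: "negligible (convex hull ?W \<inter> convex hull ?W')"
    using halves_meet tri V negligible_hull_pair negligible_subset by metis
  have W: "?W \<in> children V e" "?W' \<in> children V e" using c by auto
  have "interior (convex hull ?W \<inter> convex hull ?W') = {}"
    using n negligible_convex_interior convex_Int convex_convex_hull by metis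
  moreover have "x \<noteq> midpoint x y" using V(3) by (metis distinct_length_2_or_more midpoint_eq_endpoint(1))
  then have "?W \<noteq> ?W'" using V(3) by auto
  moreover have "convex hull V = convex hull ?W \<union> convex hull ?W'"
    using halves_cover[of o' x y] child_props(3)[OF tri e W(1)] child_props(3)[OF tri e W(2)] V by auto
  ultimately show ?thesis using that[OF c] n by auto
qed

section \<open>Lebesgue spaces on subsets of the plane\<close>

text \<open>
  The quantity that is combined by \<open>agg\<close>: for finite \<open>p\<close> it is the integral of \<open>\<bar>F\<bar>\<^sup>p\<close>.
\<close>

definition Lp_mass :: "ennreal \<Rightarrow> point set \<Rightarrow> (point \<Rightarrow> real) \<Rightarrow> real" where
  "Lp_mass p T F = (if p = \<infinity> then Lp_norm p T F else Lp_norm p T F powr enn2real p)"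

lemma enn2real_ge_1: "1 \<le> p \<Longrightarrow> p \<noteq> \<infinity> \<Longrightarrow> 1 \<le> enn2real p"
  using enn2real_mono[of 1 p] by (simp add: top.not_eq_extremum)

lemma Lp_mass_finite:
  assumes "1 \<le> p" "p \<noteq> \<infinity>"
  shows "Lp_mass p T F = (LINT x|lebesgue_on T. \<bar>F x\<bar> powr enn2real p)"
proof -
  have "0 \<le> (LINT x|lebesgue_on T. \<bar>F x\<bar> powr enn2real p)" by simp
  with enn2real_ge_1[OF assms] assms show ?thesis
    by (simp add: Lp_mass_def Lp_norm_def powr_powr)
qed

text \<open>
  For \<open>p = \<infinity>\<close> the essential supremum of a nonnegative function is negative only on a null
  space, where it is \<open>-\<infinity>\<close>; its value as a real number is \<open>0\<close> by convention.
\<close>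

lemma Lp_norm_nonneg: "0 \<le> Lp_norm p T F"
proof (cases "p = \<infinity>")
  case True
  show ?thesis
  proof (cases "0 \<le> esssup (lebesgue_on T) (\<lambda>x. ereal \<bar>F x\<bar>)")
    case False
    then have "AE x in lebesgue_on T. False"
      using esssup_AE[of "\<lambda>x. ereal \<bar>F x\<bar>" "lebesgue_on T"]
      by (auto elim!: eventually_mono dest: order_le_less_trans simp: not_le)
    moreover have "(\<lambda>x. ereal \<bar>F x\<bar>) \<in> borel_measurable (lebesgue_on T)"
      using False by (metis esssup_non_measurable top_greatest)
    ultimately have "esssup (lebesgue_on T) (\<lambda>x. ereal \<bar>F x\<bar>) \<le> -\<infinity>"
      by (intro esssup_I) auto
    then show ?thesis using True by (simp add: Lp_norm_def)
  qed (simp add: True Lp_norm_def real_of_ereal_pos)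
qed (simp add: Lp_norm_def)

lemma Lp_mass_nonneg: "0 \<le> Lp_mass p T F"
  by (simp add: Lp_mass_def Lp_norm_nonneg)

text \<open>
  Together with \<open>Lp_mass_infty_AE\<close> this reduces every estimate for \<open>p = \<infinity>\<close> to pointwise bounds
  that hold almost everywhere, so that no extended real arithmetic is needed later.
\<close>

lemma Lp_mass_infty_le:
  assumes "F \<in> Lp_space \<infinity> T" "0 \<le> M" "AE x in lebesgue_on T. \<bar>F x\<bar> \<le> M"
  shows "Lp_mass \<infinity> T F \<le> M"
proof -
  have "esssup (lebesgue_on T) (\<lambda>x. ereal \<bar>F x\<bar>) \<le> ereal M"
    using assms by (intro esssup_I) (auto simp: Lp_space_def)
  then show ?thesis
    using assms(2) by (cases "esssup (lebesgue_on T) (\<lambda>x. ereal \<bar>F x\<bar>)")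
      (auto simp: Lp_mass_def Lp_norm_def)
qed

lemma Lp_mass_infty_AE:
  assumes "F \<in> Lp_space \<infinity> T"
  shows "AE x in lebesgue_on T. \<bar>F x\<bar> \<le> Lp_mass \<infinity> T F"
proof -
  let ?s = "esssup (lebesgue_on T) (\<lambda>x. ereal \<bar>F x\<bar>)"
  have "?s < \<infinity>" using assms by (simp add: Lp_space_def)
  then have "ereal a \<le> ?s \<Longrightarrow> a \<le> real_of_ereal ?s" for a by (cases ?s) auto
  then show ?thesis
    using esssup_AE[of "\<lambda>x. ereal \<bar>F x\<bar>" "lebesgue_on T"]
    by (auto simp: Lp_mass_def Lp_norm_def elim!: eventually_mono)
qed

lemma Lp_space_infty_I:
  assumes "F \<in> borel_measurable (lebesgue_on T)" "AE x in lebesgue_on T. \<bar>F x\<bar> \<le> M"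
  shows "F \<in> Lp_space \<infinity> T"
proof -
  have "esssup (lebesgue_on T) (\<lambda>x. ereal \<bar>F x\<bar>) \<le> ereal M"
    using assms by (intro esssup_I) auto
  then show ?thesis using assms(1) by (auto simp: Lp_space_def dest: order_le_less_trans)
qed

lemma lebesgue_on_subset_AE:
  assumes "T \<subseteq> S" "T \<in> sets lebesgue" "S \<in> sets lebesgue" "AE x in lebesgue_on S. P x"
  shows "AE x in lebesgue_on T. P x"
  using assms by (auto simp: AE_restrict_space_iff elim!: eventually_mono)

lemma integrable_set: "T \<in> sets lebesgue \<Longrightarrow>
    integrable (lebesgue_on T) (f :: point \<Rightarrow> real) \<longleftrightarrow> set_integrable lebesgue T f"
  by (simp add: integrable_restrict_space set_integrable_def)

lemma integral_set: "T \<in> sets lebesgue \<Longrightarrow>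
    (LINT x|lebesgue_on T. (f :: point \<Rightarrow> real) x) = set_lebesgue_integral lebesgue T f"
  by (simp add: integral_restrict_space set_lebesgue_integral_def)

lemma Lp_space_subset:
  assumes "F \<in> Lp_space p S" "T \<subseteq> S" "T \<in> sets lebesgue" "S \<in> sets lebesgue"
  shows "F \<in> Lp_space p T"
proof -
  have m: "F \<in> borel_measurable (lebesgue_on T)"
    using assms by (auto simp: Lp_space_def intro: measurable_restrict_mono)
  show ?thesis
  proof (cases "p = \<infinity>")
    case True
    show ?thesis
      using Lp_space_infty_I[OF m] lebesgue_on_subset_AE[OF assms(2-4) Lp_mass_infty_AE]
        assms(1) True by blast
  next
    case False
    then show ?thesis using m assms
      by (auto simp: Lp_space_def integrable_set intro: set_integrable_subset)
  qed
qed

lemma Lp_space_dominated: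
  assumes "1 \<le> p" "F \<in> borel_measurable (lebesgue_on T)" "G \<in> Lp_space p T"
    and "\<And>x. x \<in> T \<Longrightarrow> \<bar>F x\<bar> \<le> \<bar>G x\<bar>"
  shows "F \<in> Lp_space p T"
proof (cases "p = \<infinity>")
  case True
  have "AE x in lebesgue_on T. \<bar>F x\<bar> \<le> Lp_mass p T G"
    using Lp_mass_infty_AE[OF assms(3)[unfolded True]] AE_space
  proof eventually_elim
    case (elim x)
    then show ?case using assms(4)[of x] True by (simp add: space_restrict_space)
  qed
  with True assms(2) show ?thesis using Lp_space_infty_I by blast
next
  case False
  have "integrable (lebesgue_on T) (\<lambda>x. \<bar>F x\<bar> powr enn2real p)"
  proof (rule Bochner_Integration.integrable_bound)
    show "integrable (lebesgue_on T) (\<lambda>x. \<bar>G x\<bar> powr enn2real p)"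
      using assms(3) False by (simp add: Lp_space_def)
    show "AE x in lebesgue_on T. norm (\<bar>F x\<bar> powr enn2real p) \<le> norm (\<bar>G x\<bar> powr enn2real p)"
      using assms(4) by (intro AE_I2) (auto simp: space_restrict_space intro!: powr_mono2)
  qed (use assms(2) in measurable)
  with assms(2) False show ?thesis by (simp add: Lp_space_def)
qed

lemma Lp_mass_dominated:
  assumes "1 \<le> p" "F \<in> borel_measurable (lebesgue_on T)" "G \<in> Lp_space p T"
    and le: "\<And>x. x \<in> T \<Longrightarrow> \<bar>F x\<bar> \<le> \<bar>G x\<bar>"
  shows "Lp_mass p T F \<le> Lp_mass p T G"
proof (cases "p = \<infinity>")
  case True
  have "AE x in lebesgue_on T. \<bar>F x\<bar> \<le> Lp_mass p T G"
    using Lp_mass_infty_AE[OF assms(3)[unfolded True]] AE_space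
  proof eventually_elim
    case (elim x)
    then show ?case using assms(4)[of x] True by (simp add: space_restrict_space)
  qed
  then show ?thesis
    using Lp_mass_infty_le[OF _ Lp_mass_nonneg] Lp_space_dominated[OF assms] True by blast
next
  case False
  show ?thesis
    unfolding Lp_mass_finite[OF assms(1) False]
  proof (rule integral_mono_AE)
    show "AE x in lebesgue_on T. \<bar>F x\<bar> powr enn2real p \<le> \<bar>G x\<bar> powr enn2real p"
      using le by (intro AE_I2) (auto simp: space_restrict_space intro!: powr_mono2)
  qed (use Lp_space_dominated[OF assms] assms(3) False in \<open>auto simp: Lp_space_def\<close>)
qed

lemma Lp_mass_subset:
  assumes "1 \<le> p" "F \<in> Lp_space p S" "T \<subseteq> S" "T \<in> sets lebesgue" "S \<in> sets lebesgue"
  shows "Lp_mass p T F \<le> Lp_mass p S F"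
proof (cases "p = \<infinity>")
  case True
  then show ?thesis
    using Lp_mass_infty_le[OF _ Lp_mass_nonneg lebesgue_on_subset_AE[OF assms(3-5) Lp_mass_infty_AE]]
      Lp_space_subset[OF assms(2-5)] assms(2) by blast
next
  case False
  have int: "set_integrable lebesgue S (\<lambda>x. \<bar>F x\<bar> powr enn2real p)"
    "set_integrable lebesgue T (\<lambda>x. \<bar>F x\<bar> powr enn2real p)"
    using assms False Lp_space_subset[OF assms(2-5)] by (simp_all add: Lp_space_def integrable_set)
  show ?thesis
    unfolding Lp_mass_finite[OF assms(1) False] integral_set[OF assms(4)] integral_set[OF assms(5)]
      set_lebesgue_integral_def
    by (rule integral_mono)
      (use int assms(3) in \<open>auto simp: set_integrable_def indicator_def\<close>)
qed

lemma Lp_mass_disjoint: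
  assumes "1 \<le> p" "F \<in> Lp_space p (T \<union> T')" "T \<in> sets lebesgue" "T' \<in> sets lebesgue"
    and "negligible (T \<inter> T')" "p \<noteq> \<infinity>"
  shows "Lp_mass p T F + Lp_mass p T' F = Lp_mass p (T \<union> T') F"
proof -
  have "F \<in> Lp_space p T" "F \<in> Lp_space p T'"
    using assms by (auto intro: Lp_space_subset)
  moreover have "AE x in lebesgue. \<not> (x \<in> T \<and> x \<in> T')"
    using assms(5) by (intro AE_I'[of "T \<inter> T'"]) (auto simp: negligible_iff_null_sets)
  ultimately show ?thesis
    using assms unfolding Lp_mass_finite[OF assms(1,6)]
    by (auto simp: integral_set Lp_space_def integrable_set intro!: set_integral_Un_AE[symmetric])
qed

lemma Lp_mass_cover:
  assumes p: "1 \<le> p" and fin: "finite \<T>" and F: "F \<in> Lp_space p (\<Union>T\<in>\<T>. h T)"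
    and m: "\<And>T. T \<in> \<T> \<Longrightarrow> h T \<in> sets lebesgue"
  shows "Lp_mass p (\<Union>T\<in>\<T>. h T) F \<le> agg p (\<lambda>T. Lp_mass p (h T) F) \<T>"
proof (cases "p = \<infinity>")
  case True
  let ?S = "\<Union>T\<in>\<T>. h T" and ?M = "agg p (\<lambda>T. Lp_mass p (h T) F) \<T>"
  have S: "?S \<in> sets lebesgue" using fin m by auto
  have "AE x in lebesgue. x \<in> h T \<longrightarrow> \<bar>F x\<bar> \<le> ?M" if "T \<in> \<T>" for T
  proof -
    have "F \<in> Lp_space p (h T)" using that m S F by (auto intro: Lp_space_subset)
    from Lp_mass_infty_AE[OF this[unfolded True]]
    have "AE x in lebesgue. x \<in> h T \<longrightarrow> \<bar>F x\<bar> \<le> Lp_mass p (h T) F"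
      using m[OF that] True by (simp add: AE_restrict_space_iff)
    moreover have "Lp_mass p (h T) F \<le> ?M"
      using that fin True by (auto simp: agg_def)
    ultimately show ?thesis by (auto elim!: eventually_mono intro: order_trans)
  qed
  then have "AE x in lebesgue. \<forall>T\<in>\<T>. x \<in> h T \<longrightarrow> \<bar>F x\<bar> \<le> ?M"
    by (rule AE_finite_allI[OF fin])
  then have "AE x in lebesgue_on ?S. \<bar>F x\<bar> \<le> ?M"
    using S by (auto simp: AE_restrict_space_iff elim!: eventually_mono)
  then show ?thesis
    using Lp_mass_infty_le[of F ?S ?M] F True fin by (auto intro: agg_nonneg Lp_mass_nonneg)
next
  case False
  let ?S = "\<Union>T\<in>\<T>. h T" and ?f = "\<lambda>x. \<bar>F x\<bar> powr enn2real p"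
  have S: "?S \<in> sets lebesgue" using fin m by auto
  have intT: "integrable lebesgue (\<lambda>x. indicator (h T) x *\<^sub>R ?f x)" if "T \<in> \<T>" for T
  proof -
    have "F \<in> Lp_space p (h T)" using that m S F by (auto intro: Lp_space_subset)
    then show ?thesis using False m[OF that] by (simp add: Lp_space_def integrable_set set_integrable_def)
  qed
  have "Lp_mass p ?S F = (LINT x|lebesgue. indicator ?S x *\<^sub>R ?f x)"
    by (simp only: Lp_mass_finite[OF p False] integral_set[OF S] set_lebesgue_integral_def)
  also have "\<dots> \<le> (LINT x|lebesgue. (\<Sum>T\<in>\<T>. indicator (h T) x *\<^sub>R ?f x))"
  proof (rule integral_mono)
    show "integrable lebesgue (\<lambda>x. indicator ?S x *\<^sub>R ?f x)"
      using F False S by (simp add: Lp_space_def integrable_set set_integrable_def)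
    show "integrable lebesgue (\<lambda>x. \<Sum>T\<in>\<T>. indicator (h T) x *\<^sub>R ?f x)"
      using intT by (rule Bochner_Integration.integrable_sum)
    fix x :: point
    have nn: "0 \<le> (\<Sum>T\<in>\<T>. indicator (h T) x *\<^sub>R ?f x)" by (intro sum_nonneg) auto
    show "indicator ?S x *\<^sub>R ?f x \<le> (\<Sum>T\<in>\<T>. indicator (h T) x *\<^sub>R ?f x)"
    proof (cases "x \<in> ?S")
      case True
      then obtain T where "T \<in> \<T>" "x \<in> h T" by blast
      then show ?thesis using True member_le_sum[of T \<T> "\<lambda>T. indicator (h T) x *\<^sub>R ?f x"] fin
        by simp
    next
      case False
      then show ?thesis using nn by (simp add: indicator_def)
    qed
  qed
  also have "\<dots> = (\<Sum>T\<in>\<T>. LINT x|lebesgue. indicator (h T) x *\<^sub>R ?f x)"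
    using intT by (rule Bochner_Integration.integral_sum)
  also have "\<dots> = (\<Sum>T\<in>\<T>. Lp_mass p (h T) F)"
    by (intro sum.cong refl)
      (simp only: Lp_mass_finite[OF p False] integral_set[OF m] set_lebesgue_integral_def)
  finally show ?thesis using False by (simp add: agg_def)
qed

lemma powr_add_le:
  fixes a b r :: real
  assumes "0 \<le> a" "0 \<le> b" "1 \<le> r"
  shows "(a + b) powr r \<le> 2 powr r * (a powr r + b powr r)"
proof -
  have "(a + b) powr r \<le> (2 * max a b) powr r"
    using assms by (intro powr_mono2) auto
  also have "\<dots> = 2 powr r * max a b powr r" using assms by (simp add: powr_mult)
  also have "max a b powr r \<le> a powr r + b powr r" by (simp add: max_def)
  finally show ?thesis by simp
qed

lemma Lp_space_add:
  assumes "1 \<le> p" "F \<in> Lp_space p T" "G \<in> Lp_space p T"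
  shows "(\<lambda>x. F x + G x) \<in> Lp_space p T"
proof (cases "p = \<infinity>")
  case True
  have "AE x in lebesgue_on T. \<bar>F x + G x\<bar> \<le> Lp_mass \<infinity> T F + Lp_mass \<infinity> T G"
    using Lp_mass_infty_AE[of F T] Lp_mass_infty_AE[of G T] assms True by auto
  moreover have "(\<lambda>x. F x + G x) \<in> borel_measurable (lebesgue_on T)"
    using assms by (auto simp: Lp_space_def)
  ultimately show ?thesis using True Lp_space_infty_I by blast
next
  case False
  have [measurable]: "F \<in> borel_measurable (lebesgue_on T)" "G \<in> borel_measurable (lebesgue_on T)"
    using assms by (auto simp: Lp_space_def)
  have "integrable (lebesgue_on T) (\<lambda>x. \<bar>F x + G x\<bar> powr enn2real p)"
  proof (rule Bochner_Integration.integrable_bound)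
    show "integrable (lebesgue_on T)
        (\<lambda>x. 2 powr enn2real p * (\<bar>F x\<bar> powr enn2real p + \<bar>G x\<bar> powr enn2real p))"
      using assms(2,3) False by (auto simp: Lp_space_def)
    have "\<bar>F x + G x\<bar> powr enn2real p \<le>
        2 powr enn2real p * (\<bar>F x\<bar> powr enn2real p + \<bar>G x\<bar> powr enn2real p)" for x
      using powr_add_le[of "\<bar>F x\<bar>" "\<bar>G x\<bar>"] enn2real_ge_1[OF assms(1) False]
      by (auto intro!: order_trans[OF powr_mono2[of "enn2real p" "\<bar>F x + G x\<bar>" "\<bar>F x\<bar> + \<bar>G x\<bar>"]])
    then show "AE x in lebesgue_on T. norm (\<bar>F x + G x\<bar> powr enn2real p) \<le>
        norm (2 powr enn2real p * (\<bar>F x\<bar> powr enn2real p + \<bar>G x\<bar> powr enn2real p))"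
      by (intro AE_I2) simp
  qed measurable
  with False show ?thesis by (simp add: Lp_space_def)
qed

lemma Lp_space_bounded:
  assumes "1 \<le> p" "T \<in> lmeasurable" "F \<in> borel_measurable (lebesgue_on T)"
    and "\<And>x. x \<in> T \<Longrightarrow> \<bar>F x\<bar> \<le> M"
  shows "F \<in> Lp_space p T"
proof (cases "p = \<infinity>")
  case True
  have "AE x in lebesgue_on T. \<bar>F x\<bar> \<le> M"
    using assms(4) by (intro AE_I2) (simp add: space_restrict_space)
  then show ?thesis
    using Lp_space_infty_I[OF assms(3)] True by simp
next
  case False
  have "(\<lambda>x. M) \<in> Lp_space p T"
  proof -
    interpret finite_measure "lebesgue_on T"
      using assms(2) by (rule finite_measure_lebesgue_on)
    show ?thesis using False by (simp add: Lp_space_def)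
  qed
  then show ?thesis
    by (rule Lp_space_dominated[OF assms(1,3)]) (use assms(4) in force)
qed

lemma continuous_Lp_space:
  assumes "1 \<le> p" "compact T" "continuous_on T F"
  shows "F \<in> Lp_space p T"
proof -
  have "bounded (F ` T)" using assms compact_continuous_image compact_imp_bounded by blast
  then obtain M where "\<And>x. x \<in> T \<Longrightarrow> \<bar>F x\<bar> \<le> M" by (auto simp: bounded_iff)
  then show ?thesis
    using assms lmeasurable_compact[OF assms(2)]
    by (intro Lp_space_bounded continuous_imp_measurable_on_sets_lebesgue) auto
qed

lemma approx_class_subset_Lp:
  assumes "1 \<le> p" "compact T" "F \<in> approx_class p T" shows "F \<in> Lp_space p T"
  using assms continuous_Lp_space by (auto simp: approx_class_def split: if_splits)

lemma approx_class_restrict: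
  assumes "F \<in> approx_class p S" "T \<subseteq> S" "compact T" "compact S"
  shows "F \<in> approx_class p T"
  using assms Lp_space_subset[of F p S T] lmeasurable_compact
  by (auto simp: approx_class_def intro: continuous_on_subset split: if_splits)

lemma poly_space_continuous: "\<pi> \<in> poly_space m \<Longrightarrow> continuous_on S \<pi>"
  by (auto simp: poly_space_def intro!: continuous_intros)

lemma poly_space_const: "(\<lambda>x. c) \<in> poly_space m"
proof -
  have "(\<Sum>i\<le>m. \<Sum>j\<le>m - i. (if i = 0 \<and> j = 0 then c else 0) * x $ 1 ^ i * x $ 2 ^ j) = c" for x :: point
  proof -
    have "(\<Sum>j\<le>m - i. (if i = 0 \<and> j = 0 then c else 0) * x $ 1 ^ i * x $ 2 ^ j)
        = (if i = 0 then c else 0)" for i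
      by (cases "i = 0") (simp_all add: if_distrib[of "\<lambda>u. u * _"] sum.delta cong: if_cong)
    then show ?thesis by (simp add: sum.delta)
  qed
  then show ?thesis unfolding poly_space_def
    by (intro CollectI exI[of _ "\<lambda>i j. if i = 0 \<and> j = 0 then c else 0"]) simp
qed

lemma Lp_mass_AE_cong:
  assumes "F \<in> borel_measurable (lebesgue_on T)" "G \<in> borel_measurable (lebesgue_on T)"
    and "AE x in lebesgue_on T. F x = G x"
  shows "Lp_mass p T F = Lp_mass p T G"
proof -
  have "esssup (lebesgue_on T) (\<lambda>x. ereal \<bar>F x\<bar>) = esssup (lebesgue_on T) (\<lambda>x. ereal \<bar>G x\<bar>)"
    using assms by (intro esssup_AE_cong) auto
  moreover have "(LINT x|lebesgue_on T. \<bar>F x\<bar> powr enn2real p) = (LINT x|lebesgue_on T. \<bar>G x\<bar> powr enn2real p)"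
    using assms by (intro integral_cong_AE) auto
  ultimately show ?thesis by (simp add: Lp_mass_def Lp_norm_def)
qed

section \<open>Approximation by functions of small oscillation\<close>

lemma Lp_mass_add_le:
  assumes "1 \<le> p" "p \<noteq> \<infinity>" "F \<in> Lp_space p T" "G \<in> Lp_space p T"
  shows "Lp_mass p T (\<lambda>x. F x + G x) \<le> 2 powr enn2real p * (Lp_mass p T F + Lp_mass p T G)"
proof -
  have int: "integrable (lebesgue_on T) (\<lambda>x. \<bar>F x\<bar> powr enn2real p)"
    "integrable (lebesgue_on T) (\<lambda>x. \<bar>G x\<bar> powr enn2real p)"
    "integrable (lebesgue_on T) (\<lambda>x. \<bar>F x + G x\<bar> powr enn2real p)"
    using assms Lp_space_add[OF assms(1,3,4)] by (auto simp: Lp_space_def)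
  have "(LINT x|lebesgue_on T. \<bar>F x + G x\<bar> powr enn2real p) \<le>
      (LINT x|lebesgue_on T. 2 powr enn2real p * (\<bar>F x\<bar> powr enn2real p + \<bar>G x\<bar> powr enn2real p))"
  proof (rule integral_mono)
    fix x
    have r: "1 \<le> enn2real p" using enn2real_ge_1[OF assms(1,2)] .
    then have "\<bar>F x + G x\<bar> powr enn2real p \<le> (\<bar>F x\<bar> + \<bar>G x\<bar>) powr enn2real p"
      by (intro powr_mono2) auto
    then show "\<bar>F x + G x\<bar> powr enn2real p \<le>
        2 powr enn2real p * (\<bar>F x\<bar> powr enn2real p + \<bar>G x\<bar> powr enn2real p)"
      using powr_add_le[of "\<bar>F x\<bar>" "\<bar>G x\<bar>", OF _ _ r] by auto
  qed (use int in auto)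
  with int show ?thesis by (simp add: Lp_mass_finite[OF assms(1,2)])
qed

definition clamp_real :: "nat \<Rightarrow> real \<Rightarrow> real" where
  "clamp_real n y = max (- real n) (min (real n) y)"

lemma clamp_real_bound: "\<bar>clamp_real n y\<bar> \<le> real n"
  by (auto simp: clamp_real_def)

lemma clamp_real_diff_bound: "\<bar>y - clamp_real n y\<bar> \<le> \<bar>y\<bar>"
  by (auto simp: clamp_real_def)

lemma clamp_real_id: "\<bar>y\<bar> \<le> real n \<Longrightarrow> clamp_real n y = y"
  by (auto simp: clamp_real_def)

lemma continuous_clamp_real: "continuous_on A (clamp_real n)"
  unfolding clamp_real_def by (intro continuous_intros)

lemma measurable_clamp_real [measurable]: "clamp_real n \<in> borel_measurable borel"
  by (rule borel_measurable_continuous_onI[OF continuous_clamp_real])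

lemma measurable_continuous_limit:
  fixes f :: "point \<Rightarrow> real"
  assumes f: "f \<in> borel_measurable (lebesgue_on S)" and S: "S \<in> sets lebesgue"
  obtains g where "\<And>n. continuous_on UNIV (g n)" "AE x in lebesgue_on S. (\<lambda>n. g n x) \<longlonglongrightarrow> f x"
proof -
  have "f measurable_on S" using f S by (simp add: measurable_on_iff_borel_measurable)
  then obtain N g where N: "negligible N" "\<And>n. continuous_on UNIV (g n)"
    "\<And>x. x \<notin> N \<Longrightarrow> (\<lambda>n. g n x) \<longlonglongrightarrow> (if x \<in> S then f x else 0)"
    unfolding measurable_on_def by blast
  have "AE x in lebesgue. x \<notin> N"
    using N(1) AE_not_in negligible_iff_null_sets by blast
  then have "AE x in lebesgue. x \<in> S \<longrightarrow> (\<lambda>n. g n x) \<longlonglongrightarrow> f x"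
    by eventually_elim (use N(3) in force)
  then have "AE x in lebesgue_on S. (\<lambda>n. g n x) \<longlonglongrightarrow> f x"
    using S by (simp add: AE_restrict_space_iff)
  with N(2) that show ?thesis by blast
qed

text \<open>
  First truncate \<open>f\<close> at a height \<open>n\<close>, then approximate it almost everywhere by continuous functions,
  truncated at the same height. Both errors tend to \<open>0\<close> by dominated convergence: the first is
  dominated by \<open>\<bar>f\<bar>\<^sup>p\<close>, the second by a constant.
\<close>

lemma Lp_continuous_dense:
  assumes p: "1 \<le> p" "p \<noteq> \<infinity>" and S: "S \<in> lmeasurable" and f: "f \<in> Lp_space p S" and "0 < \<eta>"
  obtains g where "continuous_on UNIV g" "(\<lambda>x. f x - g x) \<in> Lp_space p S"
    "Lp_mass p S (\<lambda>x. f x - g x) < \<eta>"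
proof -
  let ?r = "enn2real p" and ?M = "lebesgue_on S"
  interpret finite_measure ?M using S by (rule finite_measure_lebesgue_on)
  have r: "1 \<le> ?r" using enn2real_ge_1[OF p] .
  have fm [measurable]: "f \<in> borel_measurable ?M" and fi: "integrable ?M (\<lambda>x. \<bar>f x\<bar> powr ?r)"
    using f p by (auto simp: Lp_space_def)
  \<comment> \<open>The factor \<open>2 powr r\<close> is lost in \<open>Lp_mass_add_le\<close>, and two terms share the rest.\<close>
  define \<eta>' where "\<eta>' = \<eta> / (2 * 2 powr ?r)"
  have \<eta>': "0 < \<eta>'" using \<open>0 < \<eta>\<close> by (simp add: \<eta>'_def)
  have "(\<lambda>n. LINT x|?M. \<bar>f x - clamp_real n (f x)\<bar> powr ?r) \<longlonglongrightarrow> (LINT x|?M. 0)"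
  proof (rule integral_dominated_convergence[OF _ _ fi])
    show "AE x in ?M. (\<lambda>n. \<bar>f x - clamp_real n (f x)\<bar> powr ?r) \<longlonglongrightarrow> 0"
    proof (rule AE_I2)
      fix x
      obtain N where N: "\<bar>f x\<bar> \<le> real N" using real_arch_simple by blast
      have "\<forall>\<^sub>F n in sequentially. \<bar>f x - clamp_real n (f x)\<bar> powr ?r = 0"
        using eventually_ge_at_top[of N] by eventually_elim (use N in \<open>auto simp: clamp_real_id\<close>)
      then show "(\<lambda>n. \<bar>f x - clamp_real n (f x)\<bar> powr ?r) \<longlonglongrightarrow> 0" by (rule tendsto_eventually)
    qed
    show "AE x in ?M. norm (\<bar>f x - clamp_real n (f x)\<bar> powr ?r) \<le> \<bar>f x\<bar> powr ?r" for n
      using r by (intro AE_I2) (auto intro!: powr_mono2 clamp_real_diff_bound)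
  qed measurable
  then have "\<forall>\<^sub>F n in sequentially. (LINT x|?M. \<bar>f x - clamp_real n (f x)\<bar> powr ?r) < \<eta>'"
    using \<eta>' by (intro order_tendstoD(2)) auto
  then obtain n where n: "(LINT x|?M. \<bar>f x - clamp_real n (f x)\<bar> powr ?r) < \<eta>'"
    by (auto simp: eventually_sequentially)
  obtain g where g: "\<And>k. continuous_on UNIV (g k)" "AE x in ?M. (\<lambda>k. g k x) \<longlonglongrightarrow> f x"
    using measurable_continuous_limit[OF fm] S by blast
  have gm [measurable]: "g k \<in> borel_measurable ?M" for k
    using g(1) S by (intro continuous_imp_measurable_on_sets_lebesgue) (auto intro: continuous_on_subset)
  have "(\<lambda>k. LINT x|?M. \<bar>clamp_real n (f x) - clamp_real n (g k x)\<bar> powr ?r) \<longlonglongrightarrow> (LINT x|?M. 0)"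
  proof (rule integral_dominated_convergence)
    show "integrable ?M (\<lambda>x. (2 * real n) powr ?r)" by simp
    show "AE x in ?M. (\<lambda>k. \<bar>clamp_real n (f x) - clamp_real n (g k x)\<bar> powr ?r) \<longlonglongrightarrow> 0"
      using g(2)
    proof eventually_elim
      case (elim x)
      have "isCont (clamp_real n) (f x)"
        using continuous_clamp_real[of UNIV n] by (simp add: continuous_on_eq_continuous_at)
      then have "(\<lambda>k. clamp_real n (g k x)) \<longlonglongrightarrow> clamp_real n (f x)"
        using elim by (rule isCont_tendsto_compose)
      then have "(\<lambda>k. \<bar>clamp_real n (f x) - clamp_real n (g k x)\<bar>) \<longlonglongrightarrow> 0"
        by (auto intro!: tendsto_eq_intros)
      then show ?case
        using r by (intro tendsto_zero_powrI[where b = ?r]) auto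
    qed
    show "AE x in ?M. norm (\<bar>clamp_real n (f x) - clamp_real n (g k x)\<bar> powr ?r) \<le> (2 * real n) powr ?r" for k
    proof (rule AE_I2)
      fix x
      have "\<bar>clamp_real n (f x) - clamp_real n (g k x)\<bar> \<le> 2 * real n"
        using clamp_real_bound[of n "f x"] clamp_real_bound[of n "g k x"] by linarith
      then show "norm (\<bar>clamp_real n (f x) - clamp_real n (g k x)\<bar> powr ?r) \<le> (2 * real n) powr ?r"
        using r by (auto intro!: powr_mono2)
    qed
  qed measurable
  then have "\<forall>\<^sub>F k in sequentially. (LINT x|?M. \<bar>clamp_real n (f x) - clamp_real n (g k x)\<bar> powr ?r) < \<eta>'"
    using \<eta>' by (intro order_tendstoD(2)) auto
  then obtain k where k: "(LINT x|?M. \<bar>clamp_real n (f x) - clamp_real n (g k x)\<bar> powr ?r) < \<eta>'"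
    by (auto simp: eventually_sequentially)
  let ?g = "\<lambda>x. clamp_real n (g k x)"
  let ?F = "\<lambda>x. f x - clamp_real n (f x)" and ?G = "\<lambda>x. clamp_real n (f x) - clamp_real n (g k x)"
  have cont: "continuous_on UNIV ?g"
    using continuous_on_compose2[OF continuous_clamp_real[of UNIV n] g(1)[of k]] by simp
  have F: "?F \<in> Lp_space p S"
    by (rule Lp_space_dominated[OF p(1) _ f]) (auto simp: clamp_real_diff_bound)
  have G: "?G \<in> Lp_space p S"
  proof (rule Lp_space_bounded[OF p(1) S])
    show "\<bar>?G x\<bar> \<le> 2 * real n" for x
      using clamp_real_bound[of n "f x"] clamp_real_bound[of n "g k x"] by linarith
  qed measurable
  have "(\<lambda>x. f x - ?g x) \<in> Lp_space p S" using Lp_space_add[OF p(1) F G] by simp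
  moreover have "Lp_mass p S (\<lambda>x. f x - ?g x) < \<eta>"
  proof -
    have "Lp_mass p S (\<lambda>x. f x - ?g x) \<le> 2 powr ?r * (Lp_mass p S ?F + Lp_mass p S ?G)"
      using Lp_mass_add_le[OF p F G] by simp
    also have "\<dots> < 2 powr ?r * (\<eta>' + \<eta>')"
      using n k by (intro mult_strict_left_mono add_strict_mono) (auto simp: Lp_mass_finite[OF p])
    also have "\<dots> = \<eta>" by (simp add: \<eta>'_def)
    finally show ?thesis .
  qed
  ultimately show ?thesis using that cont by blast
qed

lemma uniform_oscillation:
  fixes g :: "point \<Rightarrow> real"
  assumes "compact S" "continuous_on S g" "0 < \<omega>"
  obtains \<delta> where "0 < \<delta>" "\<And>T. T \<subseteq> S \<Longrightarrow> diam_le T \<delta> \<Longrightarrow> \<exists>c. \<forall>x\<in>T. \<bar>g x - c\<bar> \<le> \<omega>"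
proof -
  obtain d where d: "0 < d" "\<And>x y. x \<in> S \<Longrightarrow> y \<in> S \<Longrightarrow> dist x y < d \<Longrightarrow> \<bar>g x - g y\<bar> < \<omega>"
    using compact_uniformly_continuous[OF assms(2,1)] assms(3)
    unfolding uniformly_continuous_on_def dist_real_def by (metis dist_commute)
  show ?thesis
  proof (rule that[of "d / 2"])
    fix T assume T: "T \<subseteq> S" "diam_le T (d / 2)"
    show "\<exists>c. \<forall>x\<in>T. \<bar>g x - c\<bar> \<le> \<omega>"
    proof (cases "T = {}")
      case False
      then obtain x0 where x0: "x0 \<in> T" by blast
      have "\<bar>g x - g x0\<bar> \<le> \<omega>" if "x \<in> T" for x
      proof -
        have "dist x x0 \<le> d / 2" using T(2) that x0 by (simp add: diam_le_def)
        then have "dist x x0 < d" using d(1) by linarith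
        moreover have "x \<in> S" "x0 \<in> S" using T(1) that x0 by auto
        ultimately show ?thesis using d(2)[of x x0] by linarith
      qed
      then show ?thesis by blast
    qed simp
  qed (use d in simp)
qed

text \<open>
  If \<open>g\<close> is continuous and close to \<open>f\<close> in \<open>L\<^sup>p\<close>, and if \<open>g\<close> oscillates by at most \<open>\<omega>\<close> on sets of
  diameter \<open>\<delta>\<close>, then \<open>\<bar>f - g\<bar> + \<omega>\<close> is a single function of small norm that majorizes, on every
  such set, the distance of \<open>f\<close> to a suitable constant. Having one majorant for all sets makes the
  errors on a whole family of triangles summable at once.
\<close>

lemma uniform_majorant:
  assumes p: "1 \<le> p" and S: "compact S" and f: "f \<in> approx_class p S" and \<eta>: "0 < \<eta>"
  obtains F \<delta> where "F \<in> Lp_space p S" "Lp_mass p S F \<le> \<eta>" "0 < \<delta>"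
    "\<And>T. T \<subseteq> S \<Longrightarrow> diam_le T \<delta> \<Longrightarrow> \<exists>c. \<forall>x\<in>T. \<bar>f x - c\<bar> \<le> F x"
proof (cases "p = \<infinity>")
  case True
  then have cont: "continuous_on S f" using f by (simp add: approx_class_def)
  obtain \<delta> where \<delta>: "0 < \<delta>" "\<And>T. T \<subseteq> S \<Longrightarrow> diam_le T \<delta> \<Longrightarrow> \<exists>c. \<forall>x\<in>T. \<bar>f x - c\<bar> \<le> \<eta>"
    using uniform_oscillation[OF S cont \<eta>] by blast
  have F: "(\<lambda>x. \<eta>) \<in> Lp_space p S" using continuous_Lp_space[OF p S] by simp
  then have "Lp_mass p S (\<lambda>x. \<eta>) \<le> \<eta>"
    using Lp_mass_infty_le[of "\<lambda>x. \<eta>" S \<eta>] \<eta> True by simp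
  with F \<delta> that show ?thesis by blast
next
  case False
  let ?r = "enn2real p"
  have r: "1 \<le> ?r" using enn2real_ge_1[OF p False] .
  have S': "S \<in> lmeasurable" using S by (rule lmeasurable_compact)
  interpret finite_measure "lebesgue_on S" using S' by (rule finite_measure_lebesgue_on)
  define \<mu> where "\<mu> = measure (lebesgue_on S) (space (lebesgue_on S))"
  have \<mu>: "0 \<le> \<mu>" by (simp add: \<mu>_def)
  \<comment> \<open>The factor \<open>2 powr r\<close> is lost in \<open>Lp_mass_add_le\<close>, and two terms share the rest.\<close>
  define \<eta>' where "\<eta>' = \<eta> / (2 * 2 powr ?r)"
  have \<eta>': "0 < \<eta>'" using \<eta> by (simp add: \<eta>'_def)
  have fL: "f \<in> Lp_space p S" using f False by (simp add: approx_class_def)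
  obtain g where g: "continuous_on UNIV g" "(\<lambda>x. f x - g x) \<in> Lp_space p S"
    "Lp_mass p S (\<lambda>x. f x - g x) < \<eta>'"
    using Lp_continuous_dense[OF p False S' fL \<eta>'] by blast
  \<comment> \<open>Chosen such that the constant function \<open>\<omega>\<close> has mass at most \<open>\<eta>'\<close>; adding \<open>1\<close> avoids a
    division by zero on null sets.\<close>
  define \<omega> where "\<omega> = (\<eta>' / (\<mu> + 1)) powr (1 / ?r)"
  have \<omega>: "0 < \<omega>" using \<eta>' \<mu> by (simp add: \<omega>_def)
  have "\<omega> powr ?r = \<eta>' / (\<mu> + 1)" using \<eta>' \<mu> r by (simp add: \<omega>_def powr_powr)
  then have "(\<mu> + 1) * \<omega> powr ?r = \<eta>'" using \<mu> by (simp add: field_simps)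
  then have \<omega>': "\<mu> * \<omega> powr ?r \<le> \<eta>'" 
    using powr_ge_zero[of \<omega> ?r] unfolding distrib_right by linarith
  obtain \<delta> where \<delta>: "0 < \<delta>" "\<And>T. T \<subseteq> S \<Longrightarrow> diam_le T \<delta> \<Longrightarrow> \<exists>c. \<forall>x\<in>T. \<bar>g x - c\<bar> \<le> \<omega>"
    using uniform_oscillation[OF S continuous_on_subset[OF g(1) subset_UNIV] \<omega>] by blast
  define F where "F = (\<lambda>x. \<bar>f x - g x\<bar> + \<omega>)"
  have abs: "(\<lambda>x. \<bar>f x - g x\<bar>) \<in> Lp_space p S"
    by (rule Lp_space_dominated[OF p _ g(2)]) (use g(2) in \<open>auto simp: Lp_space_def\<close>)
  have const: "(\<lambda>x. \<omega>) \<in> Lp_space p S" using continuous_Lp_space[OF p S] by simp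
  have "Lp_mass p S F \<le> 2 powr ?r * (Lp_mass p S (\<lambda>x. \<bar>f x - g x\<bar>) + Lp_mass p S (\<lambda>x. \<omega>))"
    using Lp_mass_add_le[OF p False abs const] by (simp add: F_def)
  also have "\<dots> \<le> 2 powr ?r * (\<eta>' + \<eta>')"
    using g(3) \<omega>' \<omega> by (intro mult_left_mono add_mono) (auto simp: Lp_mass_finite[OF p False] \<mu>_def)
  also have "\<dots> = \<eta>" by (simp add: \<eta>'_def)
  finally have "Lp_mass p S F \<le> \<eta>" .
  moreover have "F \<in> Lp_space p S"
    using Lp_space_add[OF p abs const] by (simp add: F_def)
  moreover have "\<exists>c. \<forall>x\<in>T. \<bar>f x - c\<bar> \<le> F x" if "T \<subseteq> S" "diam_le T \<delta>" for T
  proof -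
    obtain c where "\<forall>x\<in>T. \<bar>g x - c\<bar> \<le> \<omega>" using \<delta>(2)[OF \<open>T \<subseteq> S\<close>] \<open>diam_le T \<delta>\<close> by blast
    then have "\<bar>f x - c\<bar> \<le> F x" if "x \<in> T" for x
      using that abs_triangle_ineq[of "f x - g x" "g x - c"] by (fastforce simp: F_def)
    then show ?thesis by blast
  qed
  ultimately show ?thesis using that \<delta>(1) by blast
qed

section \<open>The modified bisection rule\<close>

lemma local_approximation_near_best:
  assumes A: "local_approximation p m A" and p: "1 \<le> p"
  obtains K where "0 \<le> K" "\<And>V f \<pi>. is_triangle V \<Longrightarrow> f \<in> approx_class p (convex hull V) \<Longrightarrow> \<pi> \<in> poly_space m \<Longrightarrow>
    Lp_mass p (convex hull V) (\<lambda>x. f x - A V f x) \<le> K * Lp_mass p (convex hull V) (\<lambda>x. f x - \<pi> x)"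
proof -
  obtain C where C: "\<And>V f. is_triangle V \<Longrightarrow> f \<in> approx_class p (convex hull V) \<Longrightarrow>
      Lp_norm p (convex hull V) (\<lambda>x. f x - A V f x)
        \<le> C * (INF \<pi> \<in> poly_space m. Lp_norm p (convex hull V) (\<lambda>x. f x - \<pi> x))"
    using A unfolding local_approximation_def by blast
  define C' where "C' = max C 0"
  have C': "Lp_norm p (convex hull V) (\<lambda>x. f x - A V f x) \<le> C' * Lp_norm p (convex hull V) (\<lambda>x. f x - \<pi> x)"
    if "is_triangle V" "f \<in> approx_class p (convex hull V)" "\<pi> \<in> poly_space m" for V f \<pi>
  proof -
    let ?I = "INF \<pi> \<in> poly_space m. Lp_norm p (convex hull V) (\<lambda>x. f x - \<pi> x)"
    have "bdd_below ((\<lambda>\<pi>. Lp_norm p (convex hull V) (\<lambda>x. f x - \<pi> x)) ` poly_space m)"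
      using Lp_norm_nonneg by (intro bdd_belowI2[of _ 0]) auto
    then have le: "?I \<le> Lp_norm p (convex hull V) (\<lambda>x. f x - \<pi> x)"
      using that(3) by (rule cINF_lower)
    have "0 \<le> ?I" using that(3) by (intro cINF_greatest) (auto intro: Lp_norm_nonneg)
    then have "C * ?I \<le> C' * ?I" by (intro mult_right_mono) (auto simp: C'_def)
    also have "\<dots> \<le> C' * Lp_norm p (convex hull V) (\<lambda>x. f x - \<pi> x)"
      using le by (intro mult_left_mono) (auto simp: C'_def)
    finally show ?thesis using C[OF that(1,2)] by linarith
  qed
  have "0 \<le> C'" by (simp add: C'_def)
  show ?thesis
  proof (rule that[of "if p = \<infinity> then C' else C' powr enn2real p"])
    show "0 \<le> (if p = \<infinity> then C' else C' powr enn2real p)" using \<open>0 \<le> C'\<close> by simp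
    fix V f \<pi> assume *: "is_triangle V" "f \<in> approx_class p (convex hull V)" "\<pi> \<in> poly_space m"
    show "Lp_mass p (convex hull V) (\<lambda>x. f x - A V f x)
      \<le> (if p = \<infinity> then C' else C' powr enn2real p) * Lp_mass p (convex hull V) (\<lambda>x. f x - \<pi> x)"
      using C'[OF *] \<open>0 \<le> C'\<close> Lp_norm_nonneg powr_mono2[of "enn2real p", OF _ Lp_norm_nonneg C'[OF *]]
      by (auto simp: Lp_mass_def powr_mult)
  qed
qed

lemma greedy_error_decay:
  assumes p: "1 \<le> p" and \<theta>: "0 < \<theta>" and fin: "finite (children V e)"
    and le: "children_error p A f V e \<le> \<theta> * local_error p A f V"
  shows "agg p (\<lambda>W. Lp_mass p (convex hull W) (\<lambda>x. f x - A W f x)) (children V e)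
    \<le> (if p = \<infinity> then \<theta> else \<theta> powr enn2real p) * Lp_mass p (convex hull V) (\<lambda>x. f x - A V f x)"
proof (cases "p = \<infinity>")
  case True
  have "local_error p A f W \<le> \<theta> * local_error p A f V" if "W \<in> children V e" for W
  proof -
    have "local_error p A f W \<le> Max (local_error p A f ` children V e)"
      using that fin by (intro Max_ge) auto
    with le True show ?thesis by (simp add: children_error_def)
  qed
  moreover have "0 \<le> \<theta> * local_error p A f V"
    using \<theta> by (simp add: local_error_def Lp_norm_nonneg)
  ultimately show ?thesis
    using fin True by (auto simp: agg_def local_error_def Lp_mass_def)
next
  case False
  let ?s = "\<Sum>W\<in>children V e. local_error p A f W powr enn2real p"
  have r: "1 \<le> enn2real p" using enn2real_ge_1[OF p False] .
  have s: "0 \<le> ?s" by (intro sum_nonneg) auto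
  have "(?s powr (1 / enn2real p)) powr enn2real p \<le> (\<theta> * local_error p A f V) powr enn2real p"
    using le False r by (intro powr_mono2) (auto simp: children_error_def)
  also have "\<dots> = \<theta> powr enn2real p * local_error p A f V powr enn2real p"
    using \<theta> by (simp add: powr_mult local_error_def Lp_norm_nonneg)
  finally show ?thesis
    using s r False by (simp add: powr_powr agg_def local_error_def Lp_mass_def)
qed

text \<open>
  The function \<open>f\<close> is fixed, and with it the whole hierarchy.
\<close>

locale modified_bisection =
  fixes p :: ennreal and m :: nat and \<theta> :: real
    and \<Omega> :: "point set" and \<D>0 :: "point set set" and v0 :: "point set \<Rightarrow> point"
    and A :: "point set \<Rightarrow> (point \<Rightarrow> real) \<Rightarrow> point \<Rightarrow> real"
    and d :: "point set \<Rightarrow> point set \<Rightarrow> (point \<Rightarrow> real) \<Rightarrow> real"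
    and R :: rule and f :: "point \<Rightarrow> real"
  assumes p: "1 \<le> p"
    and triangulation: "triangulates \<Omega> \<D>0"
    and v0: "\<And>V. V \<in> \<D>0 \<Longrightarrow> v0 V \<in> V"
    and approximation: "local_approximation p m A"
    and \<theta>: "0 < \<theta>" "\<theta> < 1"
    and rule: "modified_bisection_rule p \<Omega> \<D>0 v0 A d \<theta> R"
    and f: "f \<in> approx_class p \<Omega>"
begin

abbreviation tri :: "marked \<Rightarrow> point set" where
  "tri T \<equiv> convex hull (fst T)"

abbreviation level :: "nat \<Rightarrow> marked set" where
  "level \<equiv> hierarchy \<D>0 v0 R f"

definition kids :: "marked \<Rightarrow> marked set" where
  "kids T = (\<lambda>W. (W, edge_midpoint (R f T))) ` children (fst T) (R f T)"

text \<open>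
  The error criterion of the rule, evaluated for the edge that \<open>R\<close> actually selects. A triangle
  violating it is bisected from its newest vertex; one that satisfies it may have been bisected for
  either reason, but its error decreases in any case.
\<close>

definition greedy :: "marked \<Rightarrow> bool" where
  "greedy T \<longleftrightarrow> children_error p A f (fst T) (R f T) \<le> \<theta> * local_error p A f (fst T)"

definition greedy_kids :: "marked \<Rightarrow> marked set" where
  "greedy_kids T = (if greedy T then kids T else {})"

definition newest_kids :: "marked \<Rightarrow> marked set" where
  "newest_kids T = (if greedy T then {} else kids T)"

definition triangles :: "marked set" where
  "triangles = (\<Union>j. level j)"

definition err :: "marked \<Rightarrow> real" where
  "err T = Lp_mass p (tri T) (\<lambda>x. f x - A (fst T) f x)"

definition \<theta>' :: real where
  "\<theta>' = (if p = \<infinity> then \<theta> else \<theta> powr enn2real p)"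

lemma kids_parts: "(\<lambda>T. greedy_kids T \<union> newest_kids T) = kids"
  by (rule ext) (simp add: greedy_kids_def newest_kids_def)

lemma greedy_kids_iff: "S \<in> greedy_kids T \<longleftrightarrow> S \<in> kids T \<and> greedy T"
  and newest_kids_iff: "S \<in> newest_kids T \<longleftrightarrow> S \<in> kids T \<and> \<not> greedy T"
  by (auto simp: greedy_kids_def newest_kids_def)

lemma level_Suc: "level (Suc j) = (\<Union>T\<in>level j. kids T)"
  by (simp add: kids_def)

lemma kids_in_triangles: "T \<in> triangles \<Longrightarrow> S \<in> kids T \<Longrightarrow> S \<in> triangles"
  unfolding triangles_def using level_Suc by blast

lemma err_nonneg: "0 \<le> err T"
  by (simp add: err_def Lp_mass_nonneg)

lemma \<theta>'_less_1: "0 \<le> \<theta>'" "\<theta>' < 1"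
  using \<theta> enn2real_ge_1[OF p] powr_less_mono2[of "enn2real p" \<theta> 1] by (auto simp: \<theta>'_def)

lemma rule_cases:
  assumes "T \<in> level j" "is_triangle (fst T)" "snd T \<in> fst T"
  shows "R f T \<in> edges (fst T)" "greedy T \<or> R f T = fst T - {snd T}"
proof -
  obtain V v where T: "T = (V, v)" by (cases T)
  obtain e where e: "is_arg_min (\<lambda>e'. d V e' f) (\<lambda>e'. e' \<in> edges V) e"
    "R f (V, v) = (if children_error p A f V e \<le> \<theta> * local_error p A f V then e else V - {v})"
    using rule f assms(1) unfolding modified_bisection_rule_def T by blast
  have "e \<in> edges V" using e(1) by (simp add: is_arg_min_def)
  moreover have "V - {v} \<in> edges V"
    using assms(2,3) unfolding T by (auto simp: edges_def is_triangle_def)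
  ultimately show "R f T \<in> edges (fst T)" using e(2) T by auto
  show "greedy T \<or> R f T = fst T - {snd T}" using e(2) T by (auto simp: greedy_def)
qed

lemma level_props:
  "T \<in> level j \<Longrightarrow> is_triangle (fst T) \<and> snd T \<in> fst T \<and> tri T \<subseteq> \<Omega>"
proof (induction j arbitrary: T)
  case 0
  then show ?case using triangulation v0 by (auto simp: triangulates_def)
next
  case (Suc j)
  then obtain S where S: "S \<in> level j" "T \<in> kids S" unfolding level_Suc by blast
  have S': "is_triangle (fst S)" "snd S \<in> fst S" "tri S \<subseteq> \<Omega>" using Suc.IH[OF S(1)] by auto
  have e: "R f S \<in> edges (fst S)" using rule_cases(1)[OF S(1) S'(1,2)] .
  obtain W where W: "W \<in> children (fst S) (R f S)" "T = (W, edge_midpoint (R f S))"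
    using S(2) by (auto simp: kids_def)
  show ?case using child_props[OF S'(1) e W(1)] S'(3) W(2) by auto
qed

lemma triangles_props:
  assumes "T \<in> triangles"
  shows "is_triangle (fst T)" "snd T \<in> fst T" "tri T \<subseteq> \<Omega>" "R f T \<in> edges (fst T)"
    "greedy T \<or> R f T = fst T - {snd T}"
  using assms level_props rule_cases unfolding triangles_def by blast+

lemma finite_children: "T \<in> triangles \<Longrightarrow> finite (children (fst T) (R f T))"
  using children_two[OF triangles_props(1,4)] by (metis finite.emptyI finite.insertI)

lemma finite_kids: "T \<in> triangles \<Longrightarrow> finite (kids T)"
  by (simp add: kids_def finite_children)

lemma hull_compact: "T \<in> triangles \<Longrightarrow> compact (tri T)"
  using triangles_props(1) by (intro finite_imp_compact_convex_hull)
    (metis card.infinite is_triangle_def zero_neq_numeral)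

lemma hull_sets: "T \<in> triangles \<Longrightarrow> tri T \<in> sets lebesgue"
  using hull_compact lmeasurable_compact by blast

lemma compact_\<Omega>: "compact \<Omega>"
proof -
  have "compact (convex hull V)" if "V \<in> \<D>0" for V
    using triangulation that
    by (intro finite_imp_compact_convex_hull)
      (metis card.infinite is_triangle_def triangulates_def zero_neq_numeral)
  then show ?thesis using triangulation by (auto simp: triangulates_def)
qed

lemma \<Omega>_sets: "\<Omega> \<in> sets lebesgue"
  using compact_\<Omega> lmeasurable_compact by blast

lemma f_local: "T \<in> triangles \<Longrightarrow> f \<in> approx_class p (tri T)"
  using approx_class_restrict[OF f triangles_props(3) hull_compact compact_\<Omega>] .

lemma A_poly: "T \<in> triangles \<Longrightarrow> A (fst T) f \<in> poly_space m"
  using approximation f_local triangles_props(1) unfolding local_approximation_def by blast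

lemma residual_Lp:
  assumes "\<pi> \<in> poly_space m" shows "(\<lambda>x. f x - \<pi> x) \<in> Lp_space p \<Omega>"
proof -
  have "(\<lambda>x. - \<pi> x) \<in> Lp_space p \<Omega>"
    using assms by (intro continuous_Lp_space[OF p compact_\<Omega>] continuous_intros poly_space_continuous)
  from Lp_space_add[OF p approx_class_subset_Lp[OF p compact_\<Omega> f] this] show ?thesis by simp
qed

lemma Lp_\<Omega>_hull: "T \<in> triangles \<Longrightarrow> F \<in> Lp_space p \<Omega> \<Longrightarrow> F \<in> Lp_space p (tri T)"
  using Lp_space_subset[OF _ triangles_props(3) hull_sets \<Omega>_sets] .

lemma desc_in_triangles: "T \<in> triangles \<Longrightarrow> S \<in> desc kids j T \<Longrightarrow> S \<in> triangles"
  by (induction j arbitrary: T) (auto dest: kids_in_triangles)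

lemma finite_desc_kids: "T \<in> triangles \<Longrightarrow> finite (desc kids j T)"
proof (induction j arbitrary: T)
  case (Suc j)
  have "finite (desc kids j S)" if "S \<in> kids T" for S
    using Suc.IH[OF kids_in_triangles[OF Suc.prems that]] .
  then show ?case using finite_kids[OF Suc.prems] by simp
qed simp

text \<open>
  The two children of a triangle overlap in a null set only.
\<close>

lemma agg_mass_kids:
  assumes T: "T \<in> triangles" and F: "F \<in> Lp_space p \<Omega>"
  shows "agg p (\<lambda>S. Lp_mass p (tri S) F) (kids T) \<le> Lp_mass p (tri T) F"
proof -
  obtain W W' where W: "children (fst T) (R f T) = {W, W'}" "W \<noteq> W'"
    "tri T = convex hull W \<union> convex hull W'" "negligible (convex hull W \<inter> convex hull W')"
    using children_two[OF triangles_props(1,4)[OF T]] by metis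
  have k: "kids T = {(W, edge_midpoint (R f T)), (W', edge_midpoint (R f T))}"
    using W by (simp add: kids_def)
  have in_triangles: "S \<in> triangles" if "S \<in> kids T" for S using kids_in_triangles[OF T that] .
  have sets: "convex hull W \<in> sets lebesgue" "convex hull W' \<in> sets lebesgue"
    using hull_sets[OF in_triangles] unfolding k by force+
  have FT: "F \<in> Lp_space p (tri T)" using Lp_\<Omega>_hull[OF T F] .
  show ?thesis
  proof (cases "p = \<infinity>")
    case True
    have "Lp_mass p (tri S) F \<le> Lp_mass p (tri T) F" if "S \<in> kids T" for S
    proof (rule Lp_mass_subset[OF p FT])
      show "tri S \<subseteq> tri T" unfolding W(3) using that k by auto
    qed (use hull_sets T in_triangles that in auto)
    with True show ?thesis using finite_kids[OF T] Lp_mass_nonneg by (auto simp: agg_def)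
  next
    case False
    with Lp_mass_disjoint[OF p FT[unfolded W(3)] sets W(4) False] W(2)
    show ?thesis unfolding agg_def k W(3) by simp
  qed
qed

lemma agg_mass_desc:
  assumes T: "T \<in> triangles" and F: "F \<in> Lp_space p \<Omega>"
  shows "agg p (\<lambda>S. Lp_mass p (tri S) F) (desc kids j T) \<le> Lp_mass p (tri T) F"
  using T
proof (induction j arbitrary: T)
  case 0
  then show ?case by (simp add: agg_single Lp_mass_nonneg)
next
  case (Suc j)
  have "agg p (\<lambda>S. Lp_mass p (tri S) F) (\<Union>S\<in>kids T. desc kids j S)
      \<le> 1 * agg p (\<lambda>S. Lp_mass p (tri S) F) (kids T)"
    by (rule agg_Union_le)
      (simp_all add: finite_kids finite_desc_kids Lp_mass_nonneg Suc kids_in_triangles[OF Suc.prems])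
  with agg_mass_kids[OF Suc.prems F] show ?case by simp
qed

lemma agg_err_greedy: assumes "T \<in> triangles" shows "agg p err (greedy_kids T) \<le> \<theta>' * err T"
proof (cases "greedy T")
  case True
  have inj: "inj_on (\<lambda>W. (W, edge_midpoint (R f T))) (children (fst T) (R f T))"
    by (simp add: inj_on_def)
  have "agg p err (kids T) = agg p (\<lambda>W. Lp_mass p (convex hull W) (\<lambda>x. f x - A W f x)) (children (fst T) (R f T))"
    unfolding agg_def kids_def err_def by (simp add: sum.reindex[OF inj] image_image)
  also have "\<dots> \<le> \<theta>' * err T"
    unfolding \<theta>'_def err_def
    by (rule greedy_error_decay[OF p \<theta>(1) finite_children[OF assms]]) (use True in \<open>simp add: greedy_def\<close>)
  finally show ?thesis using True by (simp add: greedy_kids_def)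
next
  case False
  then show ?thesis using \<theta>'_less_1 err_nonneg by (simp add: greedy_kids_def)
qed

lemma kids_parts_in_triangles: "T \<in> triangles \<Longrightarrow> S \<in> greedy_kids T \<union> newest_kids T \<Longrightarrow> S \<in> triangles"
  using fun_cong[OF kids_parts, of T] kids_in_triangles by blast

text \<open>
  Iteration of \<open>rank_le_child\<close>: a step that is not greedy bisects the edge opposite to the newest
  vertex, so that it is one of the steps that lower the rank.
\<close>

lemma rank_le_many:
  assumes "T \<in> triangles" "S \<in> many greedy_kids newest_kids j n T" "rank_le r D \<delta> T" "0 \<le> \<delta>" "\<delta> \<le> 1"
  shows "rank_le (r - n) D (\<delta> / 2 ^ j) S"
  using assms
proof (induction j arbitrary: n r \<delta> T)
  case 0
  then show ?case by (auto split: if_splits)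
next
  case (Suc j)
  have step: "rank_le (if R f T = fst T - {snd T} then r - 1 else r) D (\<delta> / 2) T'" if T': "T' \<in> kids T" for T'
  proof -
    obtain W where W: "W \<in> children (fst T) (R f T)" "T' = (W, edge_midpoint (R f T))"
      using T' by (auto simp: kids_def)
    show ?thesis
      unfolding W(2)
      using rank_le_child[OF triangles_props(1,4)[OF Suc.prems(1)] W(1)
          triangles_props(2)[OF Suc.prems(1)]] Suc.prems by simp
  qed
  have mono: "rank_le r D \<delta> U" if "rank_le r' D \<delta> U" "r' \<le> r" for r r' \<delta> U
    using that by (auto simp: rank_le_def)
  consider T' where "T' \<in> kids T" "greedy T" "S \<in> many greedy_kids newest_kids j n T'"
    | T' where "T' \<in> kids T" "\<not> greedy T" "S \<in> many greedy_kids newest_kids j (n - 1) T'"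
    using Suc.prems(2) by (auto simp: greedy_kids_iff newest_kids_iff)
  then show ?case
  proof cases
    case 1
    have rank: "rank_le r D (\<delta> / 2) T'" using step[OF 1(1)] by (rule mono) auto
    then have "rank_le (r - n) D (\<delta> / 2 / 2 ^ j) S"
      using Suc.prems(4,5) by (intro Suc.IH[OF kids_in_triangles[OF Suc.prems(1) 1(1)] 1(3) rank]) auto
    then show ?thesis by simp
  next
    case 2
    have "R f T = fst T - {snd T}" using triangles_props(5)[OF Suc.prems(1)] 2(2) by blast
    then have rank: "rank_le (r - 1) D (\<delta> / 2) T'" using step[OF 2(1)] by simp
    have "rank_le (r - 1 - (n - 1)) D (\<delta> / 2 / 2 ^ j) S"
      using Suc.prems(4,5) by (intro Suc.IH[OF kids_in_triangles[OF Suc.prems(1) 2(1)] 2(3) rank]) auto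
    then have "rank_le (r - n) D (\<delta> / 2 / 2 ^ j) S" by (rule mono) auto
    then show ?thesis by simp
  qed
qed

text \<open>
  Every triangle has rank \<open>3\<close> with \<open>\<delta> = 1\<close>; three newest vertex steps lead to rank \<open>0\<close>, where all
  edges are short.
\<close>

lemma diam_le_three_newest:
  assumes "T \<in> triangles" "S \<in> many greedy_kids newest_kids L 3 T" "diam_le (fst T) D"
  shows "diam_le (fst S) ((1 - 1 / 2 ^ L) * D)"
proof -
  have "rank_le 3 D 1 T" using assms(3) by (auto simp: rank_le_def split: prod.splits)
  from rank_le_many[OF assms(1,2) this] show ?thesis by (auto simp: rank_le_def)
qed

lemma hull_kids: "T \<in> triangles \<Longrightarrow> S \<in> kids T \<Longrightarrow> tri S \<subseteq> tri T"
  unfolding kids_def by (elim imageE) (simp add: child_props(3)[OF triangles_props(1,4)])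

lemma hull_desc: "T \<in> triangles \<Longrightarrow> S \<in> desc kids j T \<Longrightarrow> tri S \<subseteq> tri T"
proof (induction j arbitrary: T)
  case (Suc j)
  then obtain T' where T': "T' \<in> kids T" "S \<in> desc kids j T'" by auto
  from Suc.IH[OF kids_in_triangles[OF Suc.prems(1) T'(1)] T'(2)] hull_kids[OF Suc.prems(1) T'(1)]
  show ?case by blast
qed simp

lemma diam_le_desc:
  assumes "T \<in> triangles" "S \<in> desc kids j T" "diam_le (fst T) D"
  shows "diam_le (fst S) D"
  using diam_le_hull[OF assms(3)] hull_desc[OF assms(1,2)] hull_subset[of "fst S" convex]
  unfolding diam_le_def by blast

lemma level_desc: "level j = (\<Union>T\<in>level 0. desc kids j T)"
proof (induction j)
  case (Suc j)
  have "desc kids (Suc j) T = (\<Union>S\<in>desc kids j T. kids S)" for T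
    using desc_add[of kids j 1 T] by simp
  with Suc show ?case by (simp add: level_Suc del: hierarchy.simps(2))
qed simp

lemma level_0_in_triangles: "T \<in> level 0 \<Longrightarrow> T \<in> triangles"
  unfolding triangles_def by blast

lemma finite_level_0: "finite (level 0)"
  using triangulation by (simp add: triangulates_def)

lemma finite_level: "finite (level j)"
  unfolding level_desc[of j] by (intro finite_UN_I finite_level_0 finite_desc_kids level_0_in_triangles)

lemma level_covers: "\<Omega> = (\<Union>T\<in>level j. tri T)"
proof (induction j)
  case 0
  then show ?case using triangulation by (auto simp: triangulates_def)
next
  case (Suc j)
  have "tri T = (\<Union>S\<in>kids T. tri S)" if "T \<in> level j" for T
  proof -
    have T: "T \<in> triangles" using that by (auto simp: triangles_def)
    obtain W W' where "children (fst T) (R f T) = {W, W'}" "tri T = convex hull W \<union> convex hull W'"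
      using children_two[OF triangles_props(1,4)[OF T]] by metis
    then show ?thesis by (auto simp: kids_def)
  qed
  then show ?case using Suc unfolding level_Suc by simp
qed

lemma level_disjoint:
  "T \<in> level j \<Longrightarrow> S \<in> level j \<Longrightarrow> T \<noteq> S \<Longrightarrow> interior (tri T) \<inter> interior (tri S) = {}"
proof (induction j arbitrary: T S)
  case 0
  then obtain V W where VW: "V \<in> \<D>0" "T = (V, v0 V)" "W \<in> \<D>0" "S = (W, v0 W)" "V \<noteq> W" by auto
  then show ?case using triangulation unfolding triangulates_def pairwise_def by simp
next
  case (Suc j)
  obtain T' S' where *: "T' \<in> level j" "T \<in> kids T'" "S' \<in> level j" "S \<in> kids S'"
    using Suc.prems unfolding level_Suc by blast
  have tris: "T' \<in> triangles" "S' \<in> triangles" using * by (auto simp: triangles_def)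
  show ?case
  proof (cases "T' = S'")
    case True
    obtain W W' where W: "children (fst T') (R f T') = {W, W'}"
      "interior (convex hull W) \<inter> interior (convex hull W') = {}"
      using children_two[OF triangles_props(1,4)[OF tris(1)]] by metis
    with * True Suc.prems(3) show ?thesis by (auto simp: kids_def)
  next
    case False
    from Suc.IH[OF *(1,3) False] show ?thesis
      using interior_mono[OF hull_kids[OF tris(1) *(2)]]
        interior_mono[OF hull_kids[OF tris(2) *(4)]] by blast
  qed
qed

lemma err_near_best:
  obtains K where "0 \<le> K" "\<And>T \<pi>. T \<in> triangles \<Longrightarrow> \<pi> \<in> poly_space m \<Longrightarrow>
    err T \<le> K * Lp_mass p (tri T) (\<lambda>x. f x - \<pi> x)"
proof -
  obtain K where K: "0 \<le> K" "\<And>V f \<pi>. is_triangle V \<Longrightarrow> f \<in> approx_class p (convex hull V) \<Longrightarrow>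
      \<pi> \<in> poly_space m \<Longrightarrow>
      Lp_mass p (convex hull V) (\<lambda>x. f x - A V f x) \<le> K * Lp_mass p (convex hull V) (\<lambda>x. f x - \<pi> x)"
    by (rule local_approximation_near_best[OF approximation p]) (rule that)
  show ?thesis
  proof (rule that[OF K(1)])
    show "err T \<le> K * Lp_mass p (tri T) (\<lambda>x. f x - \<pi> x)" if "T \<in> triangles" "\<pi> \<in> poly_space m" for T \<pi>
      unfolding err_def using K(2)[OF triangles_props(1) f_local] that by simp
  qed
qed

text \<open>
  A block consists of \<open>L\<close> consecutive levels. It is lazy if at most two of its steps are newest
  vertex bisections; otherwise it has at least three of them and shrinks the diameter.
\<close>

definition lazy_block :: "nat \<Rightarrow> marked \<Rightarrow> marked set" where
  "lazy_block L = few greedy_kids newest_kids L 2"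

definition shrinking_block :: "nat \<Rightarrow> marked \<Rightarrow> marked set" where
  "shrinking_block L = many greedy_kids newest_kids L 3"

lemma block_kids: "lazy_block L T \<union> shrinking_block L T = desc kids L T"
  using few_subset_desc[of greedy_kids newest_kids L 2 T] many_subset_desc[of greedy_kids newest_kids L 3 T]
    desc_subset_few_many[of greedy_kids newest_kids L T 2]
  unfolding kids_parts lazy_block_def shrinking_block_def
  by (auto simp: numeral_3_eq_3 numeral_2_eq_2)

lemma block_desc: "desc (\<lambda>T. lazy_block L T \<union> shrinking_block L T) B T = desc kids (B * L) T"
  unfolding block_kids by (induction B arbitrary: T) (simp_all add: desc_add)

text \<open>
  The polynomial \<open>A\<^sub>T f\<close> of an ancestor \<open>T\<close> is a competitor on all of its descendants at once, so
  that their combined error is at most \<open>K e(T)\<close>, with the same \<open>K\<close> for all levels. Hence single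
  bisections, with greedy steps uncounted, form a decaying tree; \<open>few_decay\<close> for two counted steps
  and the fraction \<open>1/2\<close> yields \<open>L\<close>, and with it the contraction that makes the blocks of length
  \<open>L\<close> a decaying tree as well.
\<close>

lemma blocks_decaying_tree:
  obtains K L where "0 \<le> K"
    "\<And>T \<pi>. T \<in> triangles \<Longrightarrow> \<pi> \<in> poly_space m \<Longrightarrow> err T \<le> K * Lp_mass p (tri T) (\<lambda>x. f x - \<pi> x)"
    "decaying_tree p (lazy_block L) (shrinking_block L) triangles err K (1 / 2)"
proof -
  obtain K where K: "0 \<le> K" "\<And>T \<pi>. T \<in> triangles \<Longrightarrow> \<pi> \<in> poly_space m \<Longrightarrow>
      err T \<le> K * Lp_mass p (tri T) (\<lambda>x. f x - \<pi> x)"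
    by (rule err_near_best) (rule that)
  have desc_err: "agg p err (desc kids j T) \<le> K * err T" if T: "T \<in> triangles" for j T
  proof -
    let ?F = "\<lambda>x. f x - A (fst T) f x"
    have "agg p err (desc kids j T) \<le> agg p (\<lambda>S. K * Lp_mass p (tri S) ?F) (desc kids j T)"
      by (intro agg_mono finite_desc_kids[OF T] order_refl K(2) desc_in_triangles[OF T] A_poly[OF T]
          mult_nonneg_nonneg K(1) Lp_mass_nonneg)
    also have "\<dots> = K * agg p (\<lambda>S. Lp_mass p (tri S) ?F) (desc kids j T)"
      using finite_desc_kids[OF T] K(1) by (rule agg_scale)
    also have "\<dots> \<le> K * err T"
      unfolding err_def using agg_mass_desc[OF T residual_Lp[OF A_poly[OF T]]] K(1)
      by (rule mult_left_mono)
    finally show ?thesis .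
  qed
  interpret decaying_tree p greedy_kids newest_kids triangles err K \<theta>'
  proof unfold_locales
    show "finite (greedy_kids T)" "finite (newest_kids T)" if "T \<in> triangles" for T
      using finite_kids[OF that] by (auto simp: greedy_kids_def newest_kids_def)
    show "greedy_kids T \<union> newest_kids T \<subseteq> triangles" if "T \<in> triangles" for T
      using kids_parts_in_triangles[OF that] by blast
  qed (use K(1) err_nonneg \<theta>'_less_1 agg_err_greedy desc_err in \<open>simp_all add: kids_parts\<close>)
  obtain L where L: "\<And>T. T \<in> triangles \<Longrightarrow> agg p err (few greedy_kids newest_kids L 2 T) \<le> 1 / 2 * err T"
    using few_decay[of "1 / 2" 2] by auto
  have "decaying_tree p (lazy_block L) (shrinking_block L) triangles err K (1 / 2)"
  proof
    show "finite (lazy_block L T)" "finite (shrinking_block L T)" if "T \<in> triangles" for T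
      using finite_desc_kids[OF that, of L] unfolding block_kids[symmetric] by auto
    show "lazy_block L T \<union> shrinking_block L T \<subseteq> triangles" if "T \<in> triangles" for T
      unfolding block_kids using desc_in_triangles[OF that] by blast
    show "agg p err (desc (\<lambda>T. lazy_block L T \<union> shrinking_block L T) B T) \<le> K * err T"
      if "T \<in> triangles" for B T
      unfolding block_desc using desc_err[OF that] .
  qed (use K(1) err_nonneg L in \<open>auto simp: lazy_block_def\<close>)
  with K that show ?thesis by blast
qed

lemma diam_le_blocks:
  assumes "T \<in> triangles" "S \<in> many (lazy_block L) (shrinking_block L) B n T" "diam_le (fst T) D" "0 \<le> D"
  shows "diam_le (fst S) ((1 - 1 / 2 ^ L) ^ n * D)"
  using assms
proof (induction B arbitrary: T n D)
  case 0
  then show ?case by (auto split: if_splits)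
next
  case (Suc B)
  define \<rho> :: real where "\<rho> = 1 - 1 / 2 ^ L"
  have \<rho>: "0 \<le> \<rho>" "\<rho> \<le> 1" by (auto simp: \<rho>_def)
  consider T' where "T' \<in> lazy_block L T" "S \<in> many (lazy_block L) (shrinking_block L) B n T'"
    | T' where "T' \<in> shrinking_block L T"
        "S \<in> many (lazy_block L) (shrinking_block L) B (n - 1) T'"
    using Suc.prems(2) by auto
  then show ?case
  proof cases
    case 1
    then have "T' \<in> desc kids L T" using block_kids by blast
    then have "diam_le (fst T') D" "T' \<in> triangles"
      using diam_le_desc Suc.prems desc_in_triangles by blast+
    then show ?thesis using Suc.IH[OF _ 1(2)] Suc.prems(4) by blast
  next
    case 2
    then have T': "T' \<in> triangles" using block_kids[of L T] desc_in_triangles[OF Suc.prems(1)] by blast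
    have "diam_le (fst T') (\<rho> * D)"
      unfolding \<rho>_def using diam_le_three_newest[OF Suc.prems(1) _ Suc.prems(3)] 2(1)
      by (simp add: shrinking_block_def)
    then have "diam_le (fst S) (\<rho> ^ (n - 1) * (\<rho> * D))"
      using Suc.IH[OF T' 2(2)] Suc.prems(4) \<rho>(1) unfolding \<rho>_def by simp
    moreover have "\<rho> ^ (n - 1) * (\<rho> * D) \<le> \<rho> ^ n * D"
      using \<rho> Suc.prems(4) by (cases n) (auto simp: mult_left_le_one_le)
    ultimately show ?thesis unfolding diam_le_def \<rho>_def by (meson order_trans)
  qed
qed

text \<open>
  On every initial triangle, the descendants reached with at most \<open>n0\<close> shrinking blocks carry a
  small part of the error by \<open>few_decay\<close>, while the others are so small that the majorant of
  \<open>uniform_majorant\<close> bounds their errors.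
\<close>

lemma level_error_small:
  assumes "0 < \<eta>"
  shows "\<exists>j. agg p err (level j) \<le> \<eta>"
proof -
  obtain K L where K: "0 \<le> K" "\<And>T \<pi>. T \<in> triangles \<Longrightarrow> \<pi> \<in> poly_space m \<Longrightarrow>
      err T \<le> K * Lp_mass p (tri T) (\<lambda>x. f x - \<pi> x)"
    and tree: "decaying_tree p (lazy_block L) (shrinking_block L) triangles err K (1 / 2)"
    by (rule blocks_decaying_tree) (rule that)
  interpret blocks: decaying_tree p "lazy_block L" "shrinking_block L" triangles err K "1 / 2"
    using tree .
  \<comment> \<open>The sum of \<open>1\<close> keeps \<open>c\<close> positive even if there are no initial triangles. Each initial
    triangle may contribute \<open>\<eta>/c\<close>, one half from each kind of descendants.\<close>
  define c where "c = real (card (level 0)) + 1"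
  have c: "0 < c" by (simp add: c_def)
  have share: "0 < a / (k + 1)" "k * (a / (k + 1)) \<le> a" if "0 < a" "0 \<le> k" for a k :: real
    using that by (auto simp: field_simps)
  have half: "0 < \<eta> / (2 * c)" using assms c by simp
  define \<eta>1 where "\<eta>1 = \<eta> / (2 * c) / (K + 1)"
  have \<eta>1: "0 < \<eta>1" "K * \<eta>1 \<le> \<eta> / (2 * c)"
    unfolding \<eta>1_def using share[OF half K(1)] .
  obtain F \<delta> where F: "F \<in> Lp_space p \<Omega>" "Lp_mass p \<Omega> F \<le> \<eta>1" "0 < \<delta>"
    "\<And>T. T \<subseteq> \<Omega> \<Longrightarrow> diam_le T \<delta> \<Longrightarrow> \<exists>c. \<forall>x\<in>T. \<bar>f x - c\<bar> \<le> F x"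
    using uniform_majorant[OF p compact_\<Omega> f \<eta>1(1)] by blast
  have err_F: "err T \<le> K * Lp_mass p (tri T) F" if T: "T \<in> triangles" "diam_le (fst T) \<delta>" for T
  proof -
    obtain a where a: "\<forall>x\<in>tri T. \<bar>f x - a\<bar> \<le> F x"
      using F(4)[OF triangles_props(3)[OF T(1)] diam_le_hull[OF T(2)]] by blast
    have "(\<lambda>x. f x - a) \<in> Lp_space p (tri T)"
      using Lp_\<Omega>_hull[OF T(1) residual_Lp[OF poly_space_const]] .
    then have "Lp_mass p (tri T) (\<lambda>x. f x - a) \<le> Lp_mass p (tri T) F"
      using a Lp_\<Omega>_hull[OF T(1) F(1)] by (intro Lp_mass_dominated[OF p]) (force simp: Lp_space_def)+
    then show ?thesis using K(2)[OF T(1) poly_space_const, of a] mult_left_mono[OF _ K(1)] by (meson order_trans)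
  qed
  obtain D where D: "0 \<le> D" "diam_le \<Omega> D"
    using compact_imp_bounded[OF compact_\<Omega>] unfolding diam_le_def bounded_two_points
    by (metis dist_commute dual_order.trans linear)
  \<comment> \<open>More than \<open>n0\<close> shrinking blocks bring the diameter of every initial triangle down to \<open>\<delta>\<close>;
    \<open>D + 1\<close> instead of \<open>D\<close> avoids a division by zero.\<close>
  define \<rho> :: real where "\<rho> = 1 - 1 / 2 ^ L"
  have \<rho>: "0 \<le> \<rho>" "\<rho> < 1" by (auto simp: \<rho>_def)
  have "\<exists>n. \<rho> ^ n < \<delta> / (D + 1)"
    using F(3) D(1) \<rho>(2) by (intro real_arch_pow_inv) auto
  then obtain n0 where n0: "\<rho> ^ n0 < \<delta> / (D + 1)" by blast
  have small: "diam_le (fst S) \<delta>"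
    if T0: "T \<in> level 0" and S: "S \<in> many (lazy_block L) (shrinking_block L) B (Suc n0) T" for S T B
  proof -
    have T: "T \<in> triangles" using T0 level_0_in_triangles by blast
    then have "diam_le (fst T) D"
      using triangles_props(3)[OF T] hull_subset[of "fst T" convex] D(2) unfolding diam_le_def by blast
    from diam_le_blocks[OF T S this D(1)] have "diam_le (fst S) (\<rho> ^ Suc n0 * D)"
      unfolding \<rho>_def .
    moreover have "\<rho> ^ Suc n0 * D \<le> \<delta>"
    proof -
      have "\<rho> ^ Suc n0 * D \<le> \<rho> ^ n0 * (D + 1)"
        using \<rho> D(1) by (intro mult_mono) (auto simp: mult_left_le_one_le)
      also have "\<dots> \<le> \<delta>" using n0 D(1) by (simp add: pos_less_divide_eq)
      finally show ?thesis .
    qed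
    ultimately show ?thesis unfolding diam_le_def by (meson order_trans)
  qed
  define w where "w = (\<Sum>T\<in>level 0. err T)"
  have w: "0 \<le> w" "\<And>T. T \<in> level 0 \<Longrightarrow> err T \<le> w"
    unfolding w_def using finite_level_0 err_nonneg by (auto intro: sum_nonneg member_le_sum)
  define \<eta>2 where "\<eta>2 = \<eta> / (2 * c) / (w + 1)"
  have \<eta>2: "0 < \<eta>2" "\<eta>2 * w \<le> \<eta> / (2 * c)"
    unfolding \<eta>2_def mult.commute[of _ w] using share[OF half w(1)] .
  obtain B where B: "\<And>T. T \<in> triangles \<Longrightarrow> agg p err (few (lazy_block L) (shrinking_block L) B n0 T) \<le> \<eta>2 * err T"
    using blocks.few_decay[OF \<eta>2(1), of n0] by blast
  have root: "agg p err (desc kids (B * L) T) \<le> \<eta> / c" if T0: "T \<in> level 0" for T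
  proof -
    have T: "T \<in> triangles" using T0 level_0_in_triangles by blast
    let ?few = "few (lazy_block L) (shrinking_block L) B n0 T"
      and ?many = "many (lazy_block L) (shrinking_block L) B (Suc n0) T"
    have sub: "?few \<subseteq> desc kids (B * L) T" "?many \<subseteq> desc kids (B * L) T"
      "desc kids (B * L) T \<subseteq> ?few \<union> ?many"
      using few_subset_desc[of "lazy_block L" "shrinking_block L" B n0 T]
        many_subset_desc[of "lazy_block L" "shrinking_block L" B "Suc n0" T]
        desc_subset_few_many[of "lazy_block L" "shrinking_block L" B T n0] unfolding block_desc by auto
    have fin: "finite ?few" "finite ?many"
      using sub finite_desc_kids[OF T] finite_subset by blast+
    have "agg p err ?many \<le> agg p (\<lambda>S. K * Lp_mass p (tri S) F) (desc kids (B * L) T)"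
    proof (rule agg_mono)
      fix S assume S: "S \<in> ?many"
      then have "S \<in> triangles" using sub desc_in_triangles[OF T] by blast
      then show "err S \<le> K * Lp_mass p (tri S) F"
        using small[OF T0 S] err_F by blast
    qed (use finite_desc_kids[OF T] sub K(1) Lp_mass_nonneg in auto)
    also have "\<dots> = K * agg p (\<lambda>S. Lp_mass p (tri S) F) (desc kids (B * L) T)"
      using finite_desc_kids[OF T] K(1) by (rule agg_scale)
    also have "\<dots> \<le> K * Lp_mass p (tri T) F"
      using agg_mass_desc[OF T F(1)] K(1) by (rule mult_left_mono)
    also have "\<dots> \<le> K * \<eta>1"
      using Lp_mass_subset[OF p F(1) triangles_props(3)[OF T] hull_sets[OF T] \<Omega>_sets] F(2) K(1)
      by (intro mult_left_mono) auto
    finally have many: "agg p err ?many \<le> \<eta> / (2 * c)" using \<eta>1(2) by linarith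
    have "agg p err ?few \<le> \<eta>2 * w"
      using B[OF T] mult_left_mono[OF w(2)[OF T0], of \<eta>2] \<eta>2(1) by linarith
    with \<eta>2(2) have few: "agg p err ?few \<le> \<eta> / (2 * c)" by linarith
    have "agg p err (desc kids (B * L) T) \<le> agg p err (?few \<union> ?many)"
      using fin sub(3) err_nonneg by (intro agg_mono) auto
    also have "\<dots> \<le> agg p err ?few + agg p err ?many"
      using fin err_nonneg by (intro agg_Un) auto
    also have "\<dots> \<le> \<eta> / (2 * c) + \<eta> / (2 * c)" using few many by (rule add_mono)
    also have "\<dots> = \<eta> / c" by (simp add: field_simps)
    finally show ?thesis .
  qed
  have "agg p err (level (B * L)) \<le> agg p (\<lambda>T. agg p err (desc kids (B * L) T)) (level 0)"
    unfolding level_desc[of "B * L"]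
    by (intro agg_Union finite_level_0 finite_desc_kids level_0_in_triangles err_nonneg)
  also have "\<dots> \<le> real (card (level 0)) * (\<eta> / c)"
    using root assms c by (intro agg_le_card finite_level_0) auto
  also have "\<dots> \<le> \<eta>" using assms c by (simp add: c_def field_simps)
  finally show ?thesis by blast
qed

text \<open>
  On a common edge the values of several triangles add up. Such points form a null set, and summing
  avoids choosing one of the triangles.
\<close>

definition approximant :: "nat \<Rightarrow> point \<Rightarrow> real" where
  "approximant j x = (\<Sum>T\<in>level j. indicator (tri T) x * A (fst T) f x)"

lemma level_in_triangles: "T \<in> level j \<Longrightarrow> T \<in> triangles"
  unfolding triangles_def by blast

lemma approximant_Lp: "approximant j \<in> Lp_space p \<Omega>"
proof -
  have poly: "A (fst T) f \<in> Lp_space p \<Omega>" if "T \<in> level j" for T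
    using A_poly[OF level_in_triangles[OF that]] by (intro continuous_Lp_space[OF p compact_\<Omega>] poly_space_continuous)
  have piece: "(\<lambda>x. indicator (tri T) x * A (fst T) f x) \<in> Lp_space p \<Omega>" if "T \<in> level j" for T
  proof (rule Lp_space_dominated[OF p _ poly[OF that]])
    have "indicat_real (tri T) \<in> borel_measurable (lebesgue_on \<Omega>)"
      using hull_sets[OF level_in_triangles[OF that]] by (intro measurable_restrict_space1) simp
    moreover have "A (fst T) f \<in> borel_measurable (lebesgue_on \<Omega>)"
      using poly[OF that] by (simp add: Lp_space_def)
    ultimately show "(\<lambda>x. indicator (tri T) x * A (fst T) f x) \<in> borel_measurable (lebesgue_on \<Omega>)"
      by (rule borel_measurable_times)
  qed (simp add: indicator_def)
  have "(\<lambda>x. \<Sum>T\<in>S. indicator (tri T) x * A (fst T) f x) \<in> Lp_space p \<Omega>" if "finite S" "S \<subseteq> level j" for S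
    using that
  proof (induction S rule: finite_induct)
    case empty
    then show ?case using continuous_Lp_space[OF p compact_\<Omega>, of "\<lambda>x. 0"] by simp
  next
    case (insert T S)
    show ?case
      unfolding sum.insert[OF insert.hyps]
      by (rule Lp_space_add[OF p piece insert.IH]) (use insert.prems in auto)
  qed
  from this[OF finite_level order_refl] show ?thesis by (simp add: approximant_def[abs_def])
qed

lemma approximant_AE:
  assumes T: "T \<in> level j"
  shows "AE x in lebesgue_on (tri T). approximant j x = A (fst T) f x"
proof -
  have null: "negligible (\<Union>S\<in>level j - {T}. tri T \<inter> tri S)"
    using finite_level level_disjoint[OF T]
    by (intro negligible_Union) (auto intro!: negligible_inter_hulls)
  then have "AE x in lebesgue. x \<notin> (\<Union>S\<in>level j - {T}. tri T \<inter> tri S)"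
    using AE_not_in negligible_iff_null_sets by blast
  then have "AE x in lebesgue. x \<in> tri T \<longrightarrow> approximant j x = A (fst T) f x"
  proof eventually_elim
    case (elim x)
    show ?case
    proof
      assume x: "x \<in> tri T"
      then have "indicator (tri S) x * A (fst S) f x = 0" if "S \<in> level j - {T}" for S
        using elim that by (auto simp: indicator_def)
      then have "(\<Sum>S\<in>level j - {T}. indicator (tri S) x * A (fst S) f x) = 0"
        by (intro sum.neutral) blast
      then show "approximant j x = A (fst T) f x"
        using x unfolding approximant_def sum.remove[OF finite_level T] by simp
    qed
  qed
  then show ?thesis using hull_sets[OF level_in_triangles[OF T]] by (simp add: AE_restrict_space_iff)
qed

lemma approximant_multires: "approximant j \<in> multires_space m \<D>0 v0 R f"
proof -
  have "\<exists>\<pi>\<in>poly_space m. AE x in lebesgue_on (convex hull V). approximant j x = \<pi> x" if "(V, v) \<in> level j" for V v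
    using approximant_AE[OF that, unfolded fst_conv] A_poly[OF level_in_triangles[OF that], unfolded fst_conv]
    by (rule bexI)
  then show ?thesis
    unfolding multires_space_def multires_space_level_def by blast
qed

lemma approximant_mass: "Lp_mass p \<Omega> (\<lambda>x. f x - approximant j x) \<le> agg p err (level j)"
proof -
  have L: "(\<lambda>x. f x - approximant j x) \<in> Lp_space p \<Omega>"
  proof -
    have "(\<lambda>x. - approximant j x) \<in> Lp_space p \<Omega>"
      by (rule Lp_space_dominated[OF p _ approximant_Lp[of j]])
        (use approximant_Lp[of j] in \<open>auto simp: Lp_space_def\<close>)
    from Lp_space_add[OF p approx_class_subset_Lp[OF p compact_\<Omega> f] this] show ?thesis by simp
  qed
  have piece: "Lp_mass p (tri T) (\<lambda>x. f x - approximant j x) = err T" if T: "T \<in> level j" for T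
    unfolding err_def
  proof (rule Lp_mass_AE_cong)
    have tris: "T \<in> triangles" using level_in_triangles[OF T] .
    show "(\<lambda>x. f x - approximant j x) \<in> borel_measurable (lebesgue_on (tri T))"
      using Lp_\<Omega>_hull[OF tris L] by (simp add: Lp_space_def)
    show "(\<lambda>x. f x - A (fst T) f x) \<in> borel_measurable (lebesgue_on (tri T))"
      using Lp_\<Omega>_hull[OF tris residual_Lp[OF A_poly[OF tris]]] by (simp add: Lp_space_def)
  qed (use approximant_AE[OF T] in \<open>auto elim: eventually_mono\<close>)
  have "Lp_mass p (\<Union>T\<in>level j. tri T) (\<lambda>x. f x - approximant j x)
      \<le> agg p (\<lambda>T. Lp_mass p (tri T) (\<lambda>x. f x - approximant j x)) (level j)"
    by (rule Lp_mass_cover[OF p finite_level])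
      (use L hull_sets[OF level_in_triangles] level_covers[of j] in auto)
  also have "\<dots> \<le> agg p err (level j)"
    by (rule agg_mono) (use piece finite_level err_nonneg in auto)
  finally show ?thesis unfolding level_covers[of j, symmetric] .
qed

lemma f_in_closure: "f \<in> Lp_closure p \<Omega> (multires_space m \<D>0 v0 R f)"
  unfolding Lp_closure_def
proof (intro CollectI conjI allI impI)
  show "f \<in> Lp_space p \<Omega>" using approx_class_subset_Lp[OF p compact_\<Omega> f] .
  fix \<epsilon> :: real assume \<epsilon>: "0 < \<epsilon>"
  define \<eta> where "\<eta> = (if p = \<infinity> then \<epsilon> / 2 else (\<epsilon> / 2) powr enn2real p)"
  have "0 < \<eta>" using \<epsilon> by (simp add: \<eta>_def)
  then obtain j where "agg p err (level j) \<le> \<eta>" using level_error_small by blast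
  then have mass: "Lp_mass p \<Omega> (\<lambda>x. f x - approximant j x) \<le> \<eta>"
    using approximant_mass[of j] by linarith
  have "Lp_norm p \<Omega> (\<lambda>x. f x - approximant j x) \<le> \<epsilon> / 2"
  proof (cases "p = \<infinity>")
    case True
    with mass show ?thesis by (simp add: Lp_mass_def \<eta>_def)
  next
    case False
    show ?thesis
    proof (rule ccontr)
      assume "\<not> ?thesis"
      then have "(\<epsilon> / 2) powr enn2real p < Lp_norm p \<Omega> (\<lambda>x. f x - approximant j x) powr enn2real p"
        using \<epsilon> enn2real_ge_1[OF p False] by (intro powr_less_mono2) auto
      with mass False show False by (simp add: Lp_mass_def \<eta>_def)
    qed
  qed
  with \<epsilon> have "Lp_norm p \<Omega> (\<lambda>x. f x - approximant j x) < \<epsilon>" by linarith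
  then show "\<exists>g\<in>multires_space m \<D>0 v0 R f \<inter> Lp_space p \<Omega>. Lp_norm p \<Omega> (\<lambda>x. f x - g x) < \<epsilon>"
    using approximant_multires approximant_Lp by blast
qed

end

theorem theorem3p4:
  fixes p :: ennreal and m :: nat and \<theta> :: real
    and \<Omega> :: "point set" and \<D>0 :: "point set set" and v0 :: "point set \<Rightarrow> point"
    and A :: "point set \<Rightarrow> (point \<Rightarrow> real) \<Rightarrow> point \<Rightarrow> real"
    and d :: "point set \<Rightarrow> point set \<Rightarrow> (point \<Rightarrow> real) \<Rightarrow> real"
    and R :: rule
  assumes "1 \<le> p"
    and "triangulates \<Omega> \<D>0"
    and "\<And>V. V \<in> \<D>0 \<Longrightarrow> v0 V \<in> V"
    and "local_approximation p m A"
    and "0 < \<theta>" and "\<theta> < 1"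
    and "modified_bisection_rule p \<Omega> \<D>0 v0 A d \<theta> R"
  shows "\<forall>f \<in> approx_class p \<Omega>. f \<in> Lp_closure p \<Omega> (multires_space m \<D>0 v0 R f)"
proof
  fix f assume "f \<in> approx_class p \<Omega>"
  then interpret modified_bisection p m \<theta> \<Omega> \<D>0 v0 A d R f
    using assms by unfold_locales
  show "f \<in> Lp_closure p \<Omega> (multires_space m \<D>0 v0 R f)" by (rule f_in_closure)
qed

end
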